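(* There exists a constant $C>0$ such that for all $2 \leq s_0 \leq s \leq s_1$ and all sufficiently regular functions $u$ defined on $\mathcal{M}_{[s_0,s_1]}$, one has $$ |u(x)|\leq C(1+r)^{-1}\sum_{|I|+|J|\leq 2}\big\|\overline{\partial}_x^I\Omega^J u\big\|_{L^2(\mathcal{M}^{\text{tran}}_s\cup \mathcal{M}^{\text{ext}}_s)}, \qquad x\in \mathcal{M}^{\text{tran}}_s \cup \mathcal{M}^{\text{ext}}_s, $$ and $$ |u(x)|\leq C(1+r)^{-1}\sum_{|I|+|J|\leq 2}\big\|\partial_x^I\Omega^J u\big\|_{L^2( \mathcal{M}^{\text{ext}}_s)}, \qquad x\in \mathcal{M}^{\text{ext}}_s. $$ Here $r=|x|$, and for a point of the slice with spatial coordinate $x$, $u(x)$ denotes the value $u(T(s,|x|),x)$.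
   Context: Work in $\mathbb{R}^{3+1}$ with coordinates $(t,x)=(t,x^1,x^2,x^3)$, $r=|x|=\big(\sum_a (x^a)^2\big)^{1/2}$, $x_a=x^a$ for $a=1,2,3$. Cut-off function: let $\rho(y)=e^{-2/(1-(2y-1)^2)}$ for $0<y<1$ and $\rho(y)=0$ otherwise, $\rho_0=\int_0^1\rho(y)\,dy>0$, and $\chi(y)=\rho_0^{-1}\int_{-\infty}^y\rho(y')\,dy'$. Thus $\chi$ is smooth, $\chi=0$ for $y\le 0$, $\chi=1$ for $y\ge 1$, and $\chi$ is increasing on $(0,1)$. Transition function: $\xi(s,r)=1-\chi(r+1-s^2/2)\in[0,1]$, for $s\ge 1$, $r\ge 0$. Time function: $T=T(s,r)$ is defined for $s\ge1$, $r\ge 0$ by $$ \partial_r T(s,r)=\chi(s-1)\,\xi(s,r)\,\frac{r}{\sqrt{r^2+s^2}},\qquad T(s,0)=s . $$ The slices are $\mathcal{M}_s=\{(t,x): t=T(s,|x|)\}$, and $\mathcal{M}_{[s_0,s_1]}=\{(t,x): T(s_0,|x|)\le t\le T(s_1,|x|)\}$. Transition and exterior parts of $\mathcal{M}_s$: $$ \mathcal{M}^{\text{tran}}_s=\{t=T(s,r),\ -1+s^2/2\le r\le s^2/2\},\qquad \mathcal{M}^{\text{ext}}_s=\{t=T(s,r),\ r\ge s^2/2\} $$ (on $\mathcal{M}^{\text{ext}}_s$ the function $T(s,r)$ does not depend on $r$). Vector fields: $\partial_a=\partial/\partial x^a$; $\Omega_{ab}=x_a\partial_b-x_b\partial_a$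 (spatial rotations); $\overline{\partial}_a=\big(\partial_{x^a}T(s,r)\big)\partial_t+\partial_a$, the derivative being taken at fixed $s$. The fields $\overline{\partial}_a$ are tangent to the slices: $(\overline{\partial}_a u)(T(s,|x|),x)=\partial_{x^a}\big[u(T(s,|x|),x)\big]$. $\overline{\partial}_x^I$ denotes any $|I|$-order operator (composition of $|I|$ fields) formed from $\{\overline{\partial}_a\}_{a=1,2,3}$, $\partial_x^I$ any $|I|$-order operator formed from $\{\partial_a\}_{a=1,2,3}$, and $\Omega^J$ any $|J|$-order operator formed from the rotations $\Omega_{ab}$. The sums run over all such operators with $|I|+|J|\le 2$. The $L^2$ norm on a subset of $\mathcal{M}_s$ is taken with respect to the flat measure $dx$: $\|v\|_{L^2(A)}^2=\int |v(T(s,|x|),x)|^2\,dx$, the integral being over the spatial projection of $A\subset\mathcal{M}_s$. "Sufficiently regular" may be taken to mean smooth. *)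

theory Defs
  imports "HOL-Analysis.Analysis" "HOL-Real_Asymp.Real_Asymp"
begin

type_synonym spacetime = "real \<times> (real ^ 3)"

definition rho :: "real \<Rightarrow> real" where
  "rho y = (if 0 < y \<and> y < 1 then exp (- 2 / (1 - (2 * y - 1)\<^sup>2)) else 0)"

definition rho0 :: real where
  "rho0 = integral {0..1} rho"

definition chi :: "real \<Rightarrow> real" where
  "chi y = inverse rho0 * integral {..y} rho"

definition transition_fun :: "real \<Rightarrow> real \<Rightarrow> real" where
  "transition_fun s r = 1 - chi (r + 1 - s\<^sup>2 / 2)"

text \<open>
  The time function is the solution of an initial value problem in \<open>r\<close>, written here as an
  integral; \<open>slice_time_0\<close>, \<open>slice_time_has_derivative\<close> and \<open>slice_time_unique\<close> below say that it is
  the only solution.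
\<close>

definition slice_time_rhs :: "real \<Rightarrow> real \<Rightarrow> real" where
  "slice_time_rhs s r = chi (s - 1) * transition_fun s r * (r / sqrt (r\<^sup>2 + s\<^sup>2))"

definition slice_time :: "real \<Rightarrow> real \<Rightarrow> real" where
  "slice_time s r = s + integral {0..r} (slice_time_rhs s)"

definition slab :: "real \<Rightarrow> real \<Rightarrow> spacetime set" where
  "slab s0 s1 = {(t, x). slice_time s0 (norm x) \<le> t \<and> t \<le> slice_time s1 (norm x)}"

definition slice_tran :: "real \<Rightarrow> spacetime set" where
  "slice_tran s = {(t, x). t = slice_time s (norm x) \<and> - 1 + s\<^sup>2 / 2 \<le> norm x \<and> norm x \<le> s\<^sup>2 / 2}"

definition slice_ext :: "real \<Rightarrow> spacetime set" where
  "slice_ext s = {(t, x). t = slice_time s (norm x) \<and> s\<^sup>2 / 2 \<le> norm x}"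

text \<open>For open \<open>S\<close>, \<open>Ck_on k S f\<close> is the usual \<open>C\<^sup>k\<close> regularity: all iterated directional
  derivatives up to order \<open>k\<close> exist and are continuous on \<open>S\<close>.\<close>

fun Ck_on :: "nat \<Rightarrow> 'a::real_normed_vector set \<Rightarrow> ('a \<Rightarrow> real) \<Rightarrow> bool" where
  "Ck_on 0 S f \<longleftrightarrow> continuous_on S f"
| "Ck_on (Suc k) S f \<longleftrightarrow>
     (\<forall>p\<in>S. f differentiable (at p)) \<and> (\<forall>v. Ck_on k S (\<lambda>p. frechet_derivative f (at p) v))"

text \<open>A function is smooth on an arbitrary set (such as a closed slab) when it is smooth on an open
  neighbourhood of that set.\<close>

definition smooth_near :: "'a::real_normed_vector set \<Rightarrow> ('a \<Rightarrow> real) \<Rightarrow> bool" where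
  "smooth_near M f \<longleftrightarrow> (\<exists>U. open U \<and> M \<subseteq> U \<and> (\<forall>k. Ck_on k U f))"

definition d_t :: "(spacetime \<Rightarrow> real) \<Rightarrow> spacetime \<Rightarrow> real" where
  "d_t u p = frechet_derivative u (at p) (1, 0)"

definition d_x :: "3 \<Rightarrow> (spacetime \<Rightarrow> real) \<Rightarrow> spacetime \<Rightarrow> real" where
  "d_x a u p = frechet_derivative u (at p) (0, axis a 1)"

definition rot :: "3 \<times> 3 \<Rightarrow> (spacetime \<Rightarrow> real) \<Rightarrow> spacetime \<Rightarrow> real" where
  "rot = (\<lambda>(a, b) u p. snd p $ a * d_x b u p - snd p $ b * d_x a u p)"

text \<open>
  The coefficient of the tangent field is a derivative at fixed \<open>s\<close>, so the slice parameter is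
  kept as an argument. For fixed \<open>s\<close> the field is defined at all points, but it is tangent to the
  slice of parameter \<open>s\<close>, and it and its compositions are only used there.
\<close>

definition d_bar :: "real \<Rightarrow> 3 \<Rightarrow> (spacetime \<Rightarrow> real) \<Rightarrow> spacetime \<Rightarrow> real" where
  "d_bar s a u p =
     frechet_derivative (\<lambda>y :: real ^ 3. slice_time s (norm y)) (at (snd p)) (axis a 1) * d_t u p
     + d_x a u p"

text \<open>\<open>compose_ops D [i\<^sub>1, \<dots>, i\<^sub>m]\<close> is the operator \<open>D i\<^sub>1 \<circ> \<dots> \<circ> D i\<^sub>m\<close>.\<close>

definition compose_ops ::
    "('i \<Rightarrow> (spacetime \<Rightarrow> real) \<Rightarrow> spacetime \<Rightarrow> real) \<Rightarrow> 'i list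
      \<Rightarrow> (spacetime \<Rightarrow> real) \<Rightarrow> spacetime \<Rightarrow> real" where
  "compose_ops D is u = foldr D is u"

definition index_set :: "(3 list \<times> (3 \<times> 3) list) set" where
  "index_set = {(I, J). length I + length J \<le> 2}"

text \<open>
  The \<open>L\<^sup>2\<close> norm over a subset \<open>A\<close> of the slice of parameter \<open>s\<close> is taken with respect to \<open>dx\<close> on
  the spatial projection of \<open>A\<close>. It takes the value \<open>\<infinity>\<close> when the function is not square
  integrable.
\<close>

definition L2_slice :: "real \<Rightarrow> spacetime set \<Rightarrow> (spacetime \<Rightarrow> real) \<Rightarrow> ennreal" where
  "L2_slice s A v =
     (let I = (\<integral>\<^sup>+ x \<in> snd ` A. ennreal (\<bar>v (slice_time s (norm x), x)\<bar>\<^sup>2) \<partial>lborel)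
      in if I = \<infinity> then \<infinity> else ennreal (sqrt (enn2real I)))"

lemma finite_index_set: "finite index_set"
proof -
  have "finite {I :: 3 list. set I \<subseteq> UNIV \<and> length I \<le> 2}"
       "finite {J :: (3 \<times> 3) list. set J \<subseteq> UNIV \<and> length J \<le> 2}"
    by (intro finite_lists_length_le finite)+
  then have "finite ({I :: 3 list. length I \<le> 2} \<times> {J :: (3 \<times> 3) list. length J \<le> 2})"
    by simp
  then show ?thesis
    by (rule rev_finite_subset) (auto simp: index_set_def)
qed

lemma continuous_rho: "isCont rho y"
proof -
  let ?g = "\<lambda>y :: real. exp (- 2 / (1 - (2 * y - 1)\<^sup>2))"
  have lim: "(?g \<longlongrightarrow> 0) (at_right 0)" "(?g \<longlongrightarrow> 0) (at_left 1)"
    by real_asymp+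
  consider "y < 0" | "y = 0" | "0 < y" "y < 1" | "y = 1" | "y > 1" by linarith
  then show ?thesis
  proof cases
    case 1
    then have "\<forall>\<^sub>F x in nhds y. rho x = 0"
      by (intro eventually_nhds_in_open[of "{..<0}", THEN eventually_mono]) (auto simp: rho_def)
    then show ?thesis by (subst isCont_cong) auto
  next
    case 2
    have "(rho \<longlongrightarrow> 0) (at_right 0)"
      using lim(1) by (rule Lim_transform_eventually)
        (auto simp: rho_def eventually_at_right_field intro!: exI[of _ 1])
    moreover have "(rho \<longlongrightarrow> 0) (at_left 0)"
      by (rule Lim_transform_eventually[OF tendsto_const])
        (auto simp: rho_def eventually_at_left_field intro!: exI[of _ "-1"])
    ultimately show ?thesis
      using 2 filterlim_split_at by (auto simp: isCont_def rho_def)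
  next
    case 3
    then have "\<forall>\<^sub>F x in nhds y. rho x = ?g x"
      by (intro eventually_nhds_in_open[of "{0<..<1}", THEN eventually_mono]) (auto simp: rho_def)
    moreover have "1 - (2 * y - 1)\<^sup>2 \<noteq> 0"
    proof -
      have "1 - (2 * y - 1)\<^sup>2 = 4 * y * (1 - y)" by (simp add: power2_eq_square algebra_simps)
      then show ?thesis using 3 by simp
    qed
    then have "isCont ?g y" by (intro continuous_intros) auto
    ultimately show ?thesis by (subst isCont_cong) auto
  next
    case 4
    have "(rho \<longlongrightarrow> 0) (at_left 1)"
      using lim(2) by (rule Lim_transform_eventually)
        (auto simp: rho_def eventually_at_left_field intro!: exI[of _ 0])
    moreover have "(rho \<longlongrightarrow> 0) (at_right 1)"
      by (rule Lim_transform_eventually[OF tendsto_const])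
        (auto simp: rho_def eventually_at_right_field intro!: exI[of _ 2])
    ultimately show ?thesis
      using 4 filterlim_split_at by (auto simp: isCont_def rho_def)
  next
    case 5
    then have "\<forall>\<^sub>F x in nhds y. rho x = 0"
      by (intro eventually_nhds_in_open[of "{1<..}", THEN eventually_mono]) (auto simp: rho_def)
    then show ?thesis by (subst isCont_cong) auto
  qed
qed

lemma continuous_on_rho: "continuous_on S rho"
  using continuous_rho by (simp add: continuous_at_imp_continuous_on)

lemma rho_nonneg: "0 \<le> rho y"
  by (simp add: rho_def)

lemma rho0_pos: "0 < rho0"
proof -
  have "rho0 \<noteq> 0"
  proof
    assume "rho0 = 0"
    then have "(rho has_integral 0) (cbox 0 1)"
      using integrable_integral[OF integrable_continuous_real[OF continuous_on_rho, of 0 1]]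
      by (simp add: rho0_def)
    then have "rho (1 / 2) = 0"
      using has_integral_0_cbox_imp_0[of 0 1 rho "1 / 2"] continuous_on_rho rho_nonneg by auto
    then show False by (simp add: rho_def)
  qed
  moreover have "0 \<le> rho0"
    unfolding rho0_def using rho_nonneg
    by (intro integral_nonneg integrable_continuous_real continuous_on_rho)
  ultimately show ?thesis by simp
qed

lemma integral_rho: "integral {..y} rho = integral {a..y} rho" if "a \<le> 0"
  by (rule integral_spike_set; rule negligible_subset[OF negligible_empty])
    (use that in \<open>auto simp: rho_def split: if_splits\<close>)

lemma chi_eq_0: "chi y = 0" if "y \<le> 0"
  using that by (simp add: chi_def integral_rho[of y])

lemma chi_eq_1: "chi y = 1" if "1 \<le> y"
proof -
  have "integral {0..y} rho = rho0"
    unfolding rho0_def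
    by (rule integral_spike_set; rule negligible_subset[OF negligible_empty])
      (use that in \<open>auto simp: rho_def split: if_splits\<close>)
  then show ?thesis using rho0_pos by (simp add: chi_def integral_rho[of 0])
qed

lemma chi_has_derivative: "(chi has_real_derivative inverse rho0 * rho y) (at y)"
proof -
  define a b where "a = min 0 y - 1" and "b = y + 1"
  have "((\<lambda>y. integral {a..y} rho) has_real_derivative rho y) (at y within {a..b})"
    by (rule integral_has_real_derivative[OF continuous_on_rho]) (auto simp: a_def b_def)
  moreover have "at y within {a..b} = at y"
    by (rule at_within_interior) (auto simp: a_def b_def)
  ultimately have "((\<lambda>y. inverse rho0 * integral {a..y} rho) has_real_derivative
      inverse rho0 * rho y) (at y)"
    by (intro DERIV_cmult) simp
  moreover have "(\<lambda>y. inverse rho0 * integral {a..y} rho) = chi"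
    using integral_rho[of a] by (auto simp: chi_def a_def)
  ultimately show ?thesis by simp
qed

lemma continuous_on_chi: "continuous_on S chi"
  using chi_has_derivative DERIV_isCont continuous_at_imp_continuous_on by blast

lemma slice_time_0: "slice_time s 0 = s"
  by (simp add: slice_time_def)

lemma continuous_on_slice_time_rhs: "continuous_on S (slice_time_rhs s)" if "1 \<le> s"
proof -
  have "sqrt (r\<^sup>2 + s\<^sup>2) \<noteq> 0" for r
    using that sum_power2_eq_zero_iff[of r s] by auto
  moreover have "continuous_on S (\<lambda>r. chi (r + 1 - s\<^sup>2 / 2))"
    by (rule continuous_on_compose2[OF continuous_on_chi[of UNIV]]) (auto intro!: continuous_intros)
  ultimately show ?thesis
    unfolding slice_time_rhs_def transition_fun_def by (intro continuous_intros) auto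
qed

lemma slice_time_has_derivative:
  assumes "1 \<le> s" "0 \<le> r"
  shows "(slice_time s has_real_derivative
           chi (s - 1) * transition_fun s r * (r / sqrt (r\<^sup>2 + s\<^sup>2))) (at r within {0..})"
proof -
  have "((\<lambda>r. integral {0..r} (slice_time_rhs s)) has_real_derivative slice_time_rhs s r)
      (at r within {0..r + 1})"
    by (rule integral_has_real_derivative[OF continuous_on_slice_time_rhs]) (use assms in auto)
  moreover have "at r within {0..r + 1} = at r within {0..}"
    by (rule at_within_nhd[of _ "{..<r + 1}"]) auto
  ultimately show ?thesis
    unfolding slice_time_def[abs_def] slice_time_rhs_def[symmetric]
    by (auto intro!: derivative_eq_intros)
qed

lemma slice_time_unique:
  assumes "1 \<le> s" "0 \<le> r" "f 0 = s"
    and f: "\<And>r. 0 \<le> r \<Longrightarrow> (f has_real_derivative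
           chi (s - 1) * transition_fun s r * (r / sqrt (r\<^sup>2 + s\<^sup>2))) (at r within {0..})"
  shows "f r = slice_time s r"
proof -
  have "\<exists>c. \<forall>x\<in>{0..}. f x - slice_time s x = c"
    by (rule has_field_derivative_zero_constant)
      (auto intro!: derivative_eq_intros f slice_time_has_derivative assms)
  then obtain c where c: "\<And>x. 0 \<le> x \<Longrightarrow> f x - slice_time s x = c" by auto
  show ?thesis using c[of 0] c[of r] \<open>0 \<le> r\<close> \<open>f 0 = s\<close> by (simp add: slice_time_0)
qed

end

theory Submission
  imports Defs
begin

text \<open>
  Both inequalities are the same statement about a function on the exterior of a ball in
  \<open>\<real>\<^sup>3\<close>. On a slice, given as the graph of a radial height \<open>h\<close>, put \<open>v x = u (h x, x)\<close>. The chain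
  rule turns the tangent fields on the slice into the partial derivatives of \<open>v\<close>, and it turns
  the rotations of space-time into the rotations of \<open>\<real>\<^sup>3\<close>, because a radial height is killed by
  rotations (\<open>derivs_on_graph\<close>). On the exterior part the height is constant, so there the tangent
  fields are the plain \<open>\<partial>\<^sub>a\<close> and the second inequality is the first one for a constant height.

  It remains to bound \<open>\<bar>v x\<^sub>0\<bar>\<close>, with \<open>r\<^sub>0 = \<bar>x\<^sub>0\<bar> \<ge> R \<ge> 1\<close>, by \<open>C / r\<^sub>0\<close> times the \<open>L\<^sup>2\<close> norms of
  \<open>\<partial>\<^sup>I\<Omega>\<^sup>J v\<close> over \<open>\<bar>x\<bar> \<ge> R\<close> (\<open>exterior_estimate\<close>). A curved box with one corner at \<open>x\<^sub>0\<close>,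
  spanned by the radii in \<open>[r\<^sub>0, r\<^sub>0 + 1/2]\<close> and a square of directions of fixed size, is the image of
  a fixed cube under a polar chart \<open>patch\<close>.
  Unit steps in the chart are radial steps of size one and tangential steps of size about \<open>r\<^sub>0\<close>;
  the former are measured by \<open>\<partial>\<close>, the latter by \<open>\<Omega>\<close>, with no power of \<open>r\<^sub>0\<close> left over
  (\<open>polar_second_derivative\<close>). Hence the pulled-back function satisfies, with constants independent
  of \<open>r\<^sub>0\<close>, the embedding of \<open>H\<^sup>2\<close> into \<open>L\<^sup>\<infinity>\<close> of a three-dimensional cube. The factor \<open>1 / r\<^sub>0\<close> comes from
  the square root of the Jacobian of the chart, which is at least \<open>r\<^sub>0\<^sup>2\<close> (\<open>patch_change_of_variables\<close>).

  The embedding itself is proved from Taylor's formula at the corner of the cube along the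
  segments to all its points (\<open>radial_angular_taylor\<close>). The second-order remainder is an
  integral over dilated copies of the cube; since the dimension is three and two derivatives are
  available, the volume factors of the dilations are integrable, and averaging over the cube
  gives the bound (\<open>star_average\<close>).
\<close>

section \<open>Calculus of \<open>C\<^sup>k\<close> functions\<close>

lemma Ck_on_cong:
  assumes "open S" "\<And>p. p \<in> S \<Longrightarrow> f p = g p" "Ck_on k S f"
  shows "Ck_on k S g"
  using assms(2,3)
proof (induction k arbitrary: f g)
  case 0
  then show ?case using continuous_on_cong[of S S f g] by simp
next
  case (Suc k)
  have D: "(g has_derivative frechet_derivative f (at p)) (at p)" if "p \<in> S" for p
  proof (rule has_derivative_transform_within_open[OF _ \<open>open S\<close> that])
    show "(f has_derivative frechet_derivative f (at p)) (at p)"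
      using Suc.prems(2) that by (simp add: frechet_derivative_works)
  qed (use Suc.prems(1) in blast)
  have e: "frechet_derivative g (at p) = frechet_derivative f (at p)" if "p \<in> S" for p
    using frechet_derivative_at[OF D[OF that]] by simp
  have "Ck_on k S (\<lambda>p. frechet_derivative g (at p) v)" for v
  proof (rule Suc.IH)
    show "Ck_on k S (\<lambda>p. frechet_derivative f (at p) v)" using Suc.prems(2) by simp
  qed (simp add: e)
  moreover have "\<forall>p\<in>S. g differentiable (at p)" using D by (auto simp: differentiable_def)
  ultimately show ?case by simp
qed

lemma Ck_on_subset: "Ck_on k S f \<Longrightarrow> T \<subseteq> S \<Longrightarrow> Ck_on k T f"
  by (induction k arbitrary: f) (auto intro: continuous_on_subset)

lemma Ck_on_Suc_lower: "Ck_on (Suc k) S f \<Longrightarrow> Ck_on k S f"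
proof (induction k arbitrary: f)
  case 0
  then show ?case
    by (auto intro!: continuous_at_imp_continuous_on differentiable_imp_continuous_within)
qed auto

lemma Ck_on_mono:
  assumes "j \<le> k" "Ck_on k S f"
  shows "Ck_on j S f"
  using assms by (induction rule: inc_induct) (blast intro: Ck_on_Suc_lower)+

lemma Ck_on_SucI:
  assumes "open S" "\<And>p. p \<in> S \<Longrightarrow> (f has_derivative f' p) (at p)"
    and "\<And>v. Ck_on k S (\<lambda>p. f' p v)"
  shows "Ck_on (Suc k) S f"
proof -
  have "f' p = frechet_derivative f (at p)" if "p \<in> S" for p
    using assms(2)[OF that] frechet_derivative_at by blast
  then have "Ck_on k S (\<lambda>p. frechet_derivative f (at p) v)" for v
    by (intro Ck_on_cong[OF \<open>open S\<close> _ assms(3)]) simp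
  then show ?thesis
    using assms(2) by (auto simp: differentiable_def)
qed

lemma Ck_on_Suc_has_derivative:
  "Ck_on (Suc k) S f \<Longrightarrow> p \<in> S \<Longrightarrow> (f has_derivative frechet_derivative f (at p)) (at p)"
  by (simp add: frechet_derivative_works)

lemma Ck_on_Suc_derivative: "Ck_on (Suc k) S f \<Longrightarrow> Ck_on k S (\<lambda>p. frechet_derivative f (at p) v)"
  by simp

lemma Ck_on_const: "open S \<Longrightarrow> Ck_on k S (\<lambda>_. c)"
  by (induction k arbitrary: c) (auto simp del: Ck_on.simps(2) intro!: Ck_on_SucI[where f' = "\<lambda>_ _. 0"])

lemma Ck_on_bounded_linear:
  assumes "open S" "bounded_linear f"
  shows "Ck_on k S f"
proof (cases k)
  case 0
  then show ?thesis using assms(2) by (simp add: linear_continuous_on)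
next
  case (Suc j)
  show ?thesis unfolding Suc
    using assms by (intro Ck_on_SucI[where f' = "\<lambda>_. f"])
      (auto intro: bounded_linear_imp_has_derivative Ck_on_const)
qed

lemma Ck_on_add:
  assumes "open S"
  shows "Ck_on k S f \<Longrightarrow> Ck_on k S g \<Longrightarrow> Ck_on k S (\<lambda>p. f p + g p)"
proof (induction k arbitrary: f g)
  case (Suc k)
  show ?case
    by (rule Ck_on_SucI[OF assms has_derivative_add
        [OF Ck_on_Suc_has_derivative[OF Suc.prems(1)] Ck_on_Suc_has_derivative[OF Suc.prems(2)]]])
      (use Suc in \<open>auto intro!: Suc.IH\<close>)
qed (auto intro: continuous_on_add)

lemma Ck_on_mult:
  assumes "open S"
  shows "Ck_on k S f \<Longrightarrow> Ck_on k S g \<Longrightarrow> Ck_on k S (\<lambda>p. f p * g p)"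
proof (induction k arbitrary: f g)
  case (Suc k)
  show ?case
    by (rule Ck_on_SucI[OF assms has_derivative_mult
        [OF Ck_on_Suc_has_derivative[OF Suc.prems(1)] Ck_on_Suc_has_derivative[OF Suc.prems(2)]]], assumption+)
      (intro Ck_on_add[OF assms] Suc.IH Ck_on_Suc_lower[OF Suc.prems(1)]
        Ck_on_Suc_lower[OF Suc.prems(2)] Ck_on_Suc_derivative[OF Suc.prems(1)]
        Ck_on_Suc_derivative[OF Suc.prems(2)])
qed (auto intro: continuous_on_mult)

lemma Ck_on_diff:
  assumes "open S" "Ck_on k S f" "Ck_on k S g"
  shows "Ck_on k S (\<lambda>p. f p - g p)"
  using Ck_on_add[OF assms(1,2) Ck_on_mult[OF assms(1) Ck_on_const[OF assms(1), of k "-1"] assms(3)]]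
  by simp

lemma Ck_on_snd:
  fixes f :: "'a::real_normed_vector \<Rightarrow> real"
  assumes "open S"
  shows "Ck_on k S f \<Longrightarrow> Ck_on k (snd -` S :: ('b::real_normed_vector \<times> 'a) set) (\<lambda>p. f (snd p))"
proof (induction k arbitrary: f)
  case 0
  then show ?case
    using continuous_on_compose2[of S f "snd -` S :: ('b \<times> 'a) set" snd]
    by (auto simp: continuous_on_snd[OF continuous_on_id])
next
  case (Suc k)
  show ?case
  proof (rule Ck_on_SucI)
    show "open (snd -` S :: ('b \<times> 'a) set)"
      using assms by (rule open_vimage_snd)
    show "((\<lambda>p. f (snd p)) has_derivative (\<lambda>v. frechet_derivative f (at (snd p)) (snd v))) (at p)"
      if "p \<in> snd -` S" for p :: "'b \<times> 'a"
      using that by (intro has_derivative_compose[where g = f and f = snd] has_derivative_snd has_derivative_ident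
          Ck_on_Suc_has_derivative[OF Suc.prems]) auto
    show "Ck_on k (snd -` S) (\<lambda>p :: 'b \<times> 'a. frechet_derivative f (at (snd p)) (snd v))" for v :: "'b \<times> 'a"
      by (rule Suc.IH) (use Suc.prems in simp)
  qed
qed

lemma has_derivative_along_graph:
  fixes w :: "real \<times> 'a::real_normed_vector \<Rightarrow> real"
  assumes w: "Ck_on (Suc j) U w" and h: "Ck_on (Suc k) N h" and "x \<in> N" "(h x, x) \<in> U"
  shows "((\<lambda>x. w (h x, x)) has_derivative
    (\<lambda>v. frechet_derivative h (at x) v * frechet_derivative w (at (h x, x)) (1, 0)
         + frechet_derivative w (at (h x, x)) (0, v))) (at x)"
proof -
  let ?w = "frechet_derivative w (at (h x, x))"
  have W: "(w has_derivative ?w) (at (h x, x))"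
    by (rule Ck_on_Suc_has_derivative[OF w \<open>(h x, x) \<in> U\<close>])
  then interpret linear ?w by (rule has_derivative_linear)
  have eq: "?w (c, v) = c * ?w (1, 0) + ?w (0, v)" for c v
    using add[of "(c, 0)" "(0, v)"] scaleR[of c "(1, 0)"] by simp
  have "((\<lambda>x. w (h x, x)) has_derivative
      (\<lambda>v. ?w (frechet_derivative h (at x) v, v))) (at x)"
  proof (rule has_derivative_compose[where g = w and f = "\<lambda>x. (h x, x)", OF _ W])
    show "((\<lambda>x. (h x, x)) has_derivative (\<lambda>v. (frechet_derivative h (at x) v, v))) (at x)"
      by (rule has_derivative_Pair[OF Ck_on_Suc_has_derivative[OF h \<open>x \<in> N\<close>] has_derivative_ident])
  qed
  then show ?thesis by (subst (asm) eq)
qed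

text \<open>
  The derivative of the restriction is again built from restrictions and from derivatives of the
  height, so regularity passes to the graph by induction on the order.
\<close>

lemma Ck_on_along_graph:
  fixes w :: "real \<times> 'a::real_normed_vector \<Rightarrow> real"
  assumes G: "open G" "G \<subseteq> N" "\<And>x. x \<in> G \<Longrightarrow> (h x, x) \<in> U"
  shows "Ck_on k U w \<Longrightarrow> Ck_on k N h \<Longrightarrow> Ck_on k G (\<lambda>x. w (h x, x))"
proof (induction k arbitrary: w)
  case 0
  then show ?case
    using G continuous_on_subset[of N h G]
      continuous_on_compose2[of U w G "\<lambda>x. (h x, x)"] continuous_on_Pair[of G h "\<lambda>x. x"]
    by auto
next
  case (Suc k)
  show ?case
  proof (rule Ck_on_SucI[OF G(1) has_derivative_along_graph[OF Suc.prems]])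
    show "Ck_on k G (\<lambda>x. frechet_derivative h (at x) v * frechet_derivative w (at (h x, x)) (1, 0)
         + frechet_derivative w (at (h x, x)) (0, v))" for v
    proof -
      have "Ck_on k G (\<lambda>x. frechet_derivative h (at x) v)"
        by (rule Ck_on_subset[OF Ck_on_Suc_derivative[OF Suc.prems(2)] G(2)])
      moreover have "Ck_on k G (\<lambda>x. frechet_derivative w (at (h x, x)) c)" for c
        by (rule Suc.IH[OF Ck_on_Suc_derivative[OF Suc.prems(1)] Ck_on_Suc_lower[OF Suc.prems(2)]])
      ultimately show ?thesis
        by (intro Ck_on_add[OF G(1)] Ck_on_mult[OF G(1)])
    qed
  qed (use G in auto)
qed

text \<open>
  Schwarz's theorem. Applying the mean value theorem twice to a second difference, in one order of
  the directions and in the other, expresses it through either mixed derivative at points near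
  \<open>x\<close>; continuity of both then identifies their values at \<open>x\<close>.
\<close>

lemma second_derivative_symmetric:
  fixes w :: "'a::real_normed_vector \<Rightarrow> real"
  assumes "open G" "Ck_on 2 G w" "x \<in> G"
  shows "frechet_derivative (\<lambda>y. frechet_derivative w (at y) a) (at x) b
       = frechet_derivative (\<lambda>y. frechet_derivative w (at y) b) (at x) a"
proof -
  define D where "D u y = frechet_derivative w (at y) u" for u y
  define DD where "DD u v y = frechet_derivative (D v) (at y) u" for u v y
  have C2: "Ck_on (Suc (Suc 0)) G w" using assms(2) by (simp add: numeral_2_eq_2)
  have D: "(w has_derivative (\<lambda>u. D u y)) (at y)" if "y \<in> G" for y
    using Ck_on_Suc_has_derivative[OF C2 that] by (simp add: D_def)
  have C1: "Ck_on (Suc 0) G (D u)" for u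
    using Ck_on_Suc_derivative[OF C2] unfolding D_def .
  have DD: "(D u has_derivative (\<lambda>v. DD v u y)) (at y)" if "y \<in> G" for u y
    using Ck_on_Suc_has_derivative[OF C1 that] by (simp add: DD_def)
  have cont: "isCont (DD u v) x" for u v
    using Ck_on_Suc_derivative[OF C1] assms(1,3) by (simp add: DD_def[abs_def] continuous_on_eq_continuous_at)
  \<comment> \<open>The second difference is symmetric in \<open>u\<close> and \<open>v\<close>, so exchanging them reaches the other mixed derivative.\<close>
  have quot: "\<exists>\<theta> \<eta>. 0 < \<theta> \<and> \<theta> < s \<and> 0 < \<eta> \<and> \<eta> < s \<and>
      w (x + s *\<^sub>R u + s *\<^sub>R v) - w (x + s *\<^sub>R u) - w (x + s *\<^sub>R v) + w x
        = s * s * DD v u (x + \<theta> *\<^sub>R u + \<eta> *\<^sub>R v)"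
    if "0 < s" and B: "\<And>p q. 0 \<le> p \<Longrightarrow> p \<le> s \<Longrightarrow> 0 \<le> q \<Longrightarrow> q \<le> s \<Longrightarrow> x + p *\<^sub>R u + q *\<^sub>R v \<in> G"
    for s u v
  proof -
    have *: "((\<lambda>p. w (x + p *\<^sub>R u + q *\<^sub>R v)) has_real_derivative D u (x + p *\<^sub>R u + q *\<^sub>R v)) (at p)"
      if "0 \<le> p" "p \<le> s" "0 \<le> q" "q \<le> s" for p q
    proof -
      have y: "x + p *\<^sub>R u + q *\<^sub>R v \<in> G" using B that by auto
      then have "((\<lambda>p. w (x + p *\<^sub>R u + q *\<^sub>R v)) has_derivative (\<lambda>h. D (h *\<^sub>R u) (x + p *\<^sub>R u + q *\<^sub>R v))) (at p)"
        by (intro has_derivative_compose[where g = w and f = "\<lambda>p. x + p *\<^sub>R u + q *\<^sub>R v"] D)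
          (auto intro!: derivative_eq_intros)
      moreover have "D (h *\<^sub>R u) (x + p *\<^sub>R u + q *\<^sub>R v) = D u (x + p *\<^sub>R u + q *\<^sub>R v) * h" for h
        using linear_scale[OF has_derivative_linear[OF D[OF y]], of h u] by simp
      ultimately show ?thesis by (simp add: has_field_derivative_def)
    qed
    have "((\<lambda>p. w (x + p *\<^sub>R u + s *\<^sub>R v) - w (x + p *\<^sub>R u + 0 *\<^sub>R v)) has_real_derivative
        D u (x + p *\<^sub>R u + s *\<^sub>R v) - D u (x + p *\<^sub>R u + 0 *\<^sub>R v)) (at p)" if "0 \<le> p" "p \<le> s" for p
      using \<open>0 < s\<close> that by (intro DERIV_diff *) auto
    from MVT2[OF \<open>0 < s\<close> this] obtain \<theta> where t: "0 < \<theta>" "\<theta> < s" and 1: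
      "w (x + s *\<^sub>R u + s *\<^sub>R v) - w (x + s *\<^sub>R u) - w (x + s *\<^sub>R v) + w x
         = s * (D u (x + \<theta> *\<^sub>R u + s *\<^sub>R v) - D u (x + \<theta> *\<^sub>R u))"
      by auto
    have "((\<lambda>q. D u (x + \<theta> *\<^sub>R u + q *\<^sub>R v)) has_real_derivative DD v u (x + \<theta> *\<^sub>R u + q *\<^sub>R v)) (at q)"
      if "0 \<le> q" "q \<le> s" for q
    proof -
      have y: "x + \<theta> *\<^sub>R u + q *\<^sub>R v \<in> G" using B t that by auto
      then have "((\<lambda>q. D u (x + \<theta> *\<^sub>R u + q *\<^sub>R v)) has_derivative (\<lambda>h. DD (h *\<^sub>R v) u (x + \<theta> *\<^sub>R u + q *\<^sub>R v))) (at q)"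
        by (intro has_derivative_compose[where g = "D u" and f = "\<lambda>q. x + \<theta> *\<^sub>R u + q *\<^sub>R v"] DD)
          (auto intro!: derivative_eq_intros)
      moreover have "DD (h *\<^sub>R v) u (x + \<theta> *\<^sub>R u + q *\<^sub>R v) = DD v u (x + \<theta> *\<^sub>R u + q *\<^sub>R v) * h" for h
        using linear_scale[OF has_derivative_linear[OF DD[OF y]], of h v] by simp
      ultimately show ?thesis by (simp add: has_field_derivative_def)
    qed
    from MVT2[OF \<open>0 < s\<close> this] obtain \<eta> where "0 < \<eta>" "\<eta> < s" and
      "D u (x + \<theta> *\<^sub>R u + s *\<^sub>R v) - D u (x + \<theta> *\<^sub>R u) = s * DD v u (x + \<theta> *\<^sub>R u + \<eta> *\<^sub>R v)"
      by auto
    with t 1 show ?thesis by auto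
  qed
  have "\<bar>DD b a x - DD a b x\<bar> \<le> e" if "0 < e" for e
  proof -
    obtain d where "0 < d" and dG: "ball x d \<subseteq> G"
      using assms(1,3) open_contains_ball by blast
    obtain d1 where "0 < d1" and d1: "\<And>y. dist y x < d1 \<Longrightarrow> \<bar>DD b a y - DD b a x\<bar> < e / 2"
      using cont[of b a] \<open>0 < e\<close> unfolding continuous_at_eps_delta
      by (metis dist_real_def half_gt_zero)
    obtain d2 where "0 < d2" and d2: "\<And>y. dist y x < d2 \<Longrightarrow> \<bar>DD a b y - DD a b x\<bar> < e / 2"
      using cont[of a b] \<open>0 < e\<close> unfolding continuous_at_eps_delta
      by (metis dist_real_def half_gt_zero)
    define m where "m = min d (min d1 d2)"
    define s where "s = m / (2 * (norm a + norm b + 1))"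
    have "0 < m" using \<open>0 < d\<close> \<open>0 < d1\<close> \<open>0 < d2\<close> by (simp add: m_def)
    have np: "0 < norm a + norm b + 1" by (meson add_nonneg_pos add_nonneg_nonneg norm_ge_zero zero_less_one)
    then have "0 < s" using \<open>0 < m\<close> by (simp add: s_def)
    have near: "dist (x + p *\<^sub>R a + q *\<^sub>R b) x < m" if "0 \<le> p" "p \<le> s" "0 \<le> q" "q \<le> s" for p q
    proof -
      have "dist (x + p *\<^sub>R a + q *\<^sub>R b) x \<le> p * norm a + q * norm b"
        using norm_triangle_ineq[of "p *\<^sub>R a" "q *\<^sub>R b"] that by (simp add: dist_norm add.assoc)
      also have "\<dots> \<le> s * norm a + s * norm b"
        using that by (intro add_mono mult_right_mono) auto
      also have "\<dots> \<le> s * (norm a + norm b + 1)" using \<open>0 < s\<close> by (simp add: algebra_simps)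
      also have "\<dots> = m / 2" using np by (simp add: s_def divide_simps)
      finally show ?thesis using \<open>0 < m\<close> by simp
    qed
    have inG: "x + p *\<^sub>R a + q *\<^sub>R b \<in> G" if "0 \<le> p" "p \<le> s" "0 \<le> q" "q \<le> s" for p q
      by (rule subsetD[OF dG]) (use near[OF that] in \<open>simp add: m_def dist_commute\<close>)
    obtain \<theta> \<eta> where 1: "0 < \<theta>" "\<theta> < s" "0 < \<eta>" "\<eta> < s"
      "w (x + s *\<^sub>R a + s *\<^sub>R b) - w (x + s *\<^sub>R a) - w (x + s *\<^sub>R b) + w x
         = s * s * DD b a (x + \<theta> *\<^sub>R a + \<eta> *\<^sub>R b)"
      using quot[OF \<open>0 < s\<close> inG] by blast
    have inG': "x + p *\<^sub>R b + q *\<^sub>R a \<in> G" if "0 \<le> p" "p \<le> s" "0 \<le> q" "q \<le> s" for p q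
      using inG[OF that(3,4,1,2)] by (simp add: ac_simps)
    obtain \<theta>' \<eta>' where 2: "0 < \<theta>'" "\<theta>' < s" "0 < \<eta>'" "\<eta>' < s"
      "w (x + s *\<^sub>R b + s *\<^sub>R a) - w (x + s *\<^sub>R b) - w (x + s *\<^sub>R a) + w x
         = s * s * DD a b (x + \<theta>' *\<^sub>R b + \<eta>' *\<^sub>R a)"
      using quot[OF \<open>0 < s\<close> inG'] by blast
    have "w (x + s *\<^sub>R b + s *\<^sub>R a) = w (x + s *\<^sub>R a + s *\<^sub>R b)" by (simp add: ac_simps)
    with 1(5) 2(5) have "s * s * DD b a (x + \<theta> *\<^sub>R a + \<eta> *\<^sub>R b) = s * s * DD a b (x + \<theta>' *\<^sub>R b + \<eta>' *\<^sub>R a)"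
      by linarith
    then have "DD b a (x + \<theta> *\<^sub>R a + \<eta> *\<^sub>R b) = DD a b (x + \<eta>' *\<^sub>R a + \<theta>' *\<^sub>R b)"
      using \<open>0 < s\<close> by (simp add: ac_simps)
    moreover have "\<bar>DD b a (x + \<theta> *\<^sub>R a + \<eta> *\<^sub>R b) - DD b a x\<bar> < e / 2"
      using near[of \<theta> \<eta>] 1 by (intro d1) (auto simp: m_def)
    moreover have "\<bar>DD a b (x + \<eta>' *\<^sub>R a + \<theta>' *\<^sub>R b) - DD a b x\<bar> < e / 2"
      using near[of \<eta>' \<theta>'] 2 by (intro d2) (auto simp: m_def)
    ultimately show ?thesis by linarith
  qed
  then have "DD b a x = DD a b x"
    using field_le_epsilon[of "\<bar>DD b a x - DD a b x\<bar>" 0] by simp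
  then show ?thesis by (simp add: DD_def D_def[abs_def])
qed

section \<open>Second derivatives along curves in polar form\<close>

definition partial :: "3 \<Rightarrow> (real^3 \<Rightarrow> real) \<Rightarrow> real^3 \<Rightarrow> real" where
  "partial a w x = frechet_derivative w (at x) (axis a 1)"

definition angular :: "3 \<times> 3 \<Rightarrow> (real^3 \<Rightarrow> real) \<Rightarrow> real^3 \<Rightarrow> real" where
  "angular = (\<lambda>(a, b) w x. x $ a * partial b w x - x $ b * partial a w x)"

lemma partial_cong:
  assumes "open G" "x \<in> G" "\<And>y. y \<in> G \<Longrightarrow> f y = g y"
  shows "partial a f x = partial a g x"
proof -
  have "(f has_derivative D) (at x) \<longleftrightarrow> (g has_derivative D) (at x)" for D
    using assms has_derivative_transform_within_open[of f D x UNIV G g]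
      has_derivative_transform_within_open[of g D x UNIV G f] by auto
  then show ?thesis by (simp add: partial_def frechet_derivative_def)
qed

lemma angular_cong:
  assumes "open G" "x \<in> G" "\<And>y. y \<in> G \<Longrightarrow> f y = g y"
  shows "angular p f x = angular p g x"
proof (cases p)
  case (Pair a b)
  show ?thesis
    using partial_cong[OF assms(1,2), of f g a] partial_cong[OF assms(1,2), of f g b] assms(3)
    by (simp only: Pair angular_def prod.case)
qed

lemma Ck_on_partial: "Ck_on (Suc k) G w \<Longrightarrow> Ck_on k G (partial a w)"
  using Ck_on_Suc_derivative[of k G w "axis a 1"] by (simp add: partial_def[abs_def])

lemma Ck_on_vec_nth: "open G \<Longrightarrow> Ck_on k G (\<lambda>x :: real^3. x $ a)"
  by (rule Ck_on_bounded_linear) (auto intro: bounded_linear_vec_nth)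

lemma Ck_on_angular:
  assumes "open G" "Ck_on (Suc k) G w"
  shows "Ck_on k G (angular (a, b) w)"
  unfolding angular_def prod.case
  by (intro Ck_on_diff Ck_on_mult Ck_on_vec_nth Ck_on_partial assms)

lemma derivative_eq_sum_partial:
  assumes "(w has_derivative D) (at x)"
  shows "D v = (\<Sum>a\<in>UNIV. v $ a * partial a w x)"
proof -
  have "D v = D (\<Sum>a\<in>UNIV. v $ a *\<^sub>R axis a 1)"
    using basis_expansion[of v] by (simp add: scalar_mult_eq_scaleR)
  also have "\<dots> = (\<Sum>a\<in>UNIV. v $ a * D (axis a 1))"
    by (simp add: linear_sum[OF has_derivative_linear[OF assms]] linear_scale[OF has_derivative_linear[OF assms]])
  finally show ?thesis
    using frechet_derivative_at[OF assms] by (simp add: partial_def)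
qed

lemma has_derivative_sum_partial:
  assumes "Ck_on (Suc k) G w" "x \<in> G"
  shows "(w has_derivative (\<lambda>v. \<Sum>a\<in>UNIV. v $ a * partial a w x)) (at x)"
proof (rule has_derivative_eq_rhs[OF Ck_on_Suc_has_derivative[OF assms]])
  show "frechet_derivative w (at x) = (\<lambda>v. \<Sum>a\<in>UNIV. v $ a * partial a w x)"
    by (rule ext, rule derivative_eq_sum_partial[OF Ck_on_Suc_has_derivative[OF assms]])
qed

lemma partial_symmetric:
  assumes "open G" "Ck_on 2 G w" "x \<in> G"
  shows "partial a (partial b w) x = partial b (partial a w) x"
  using second_derivative_symmetric[OF assms] by (simp add: partial_def[abs_def])

text \<open>
  Contracted with two fixed vectors, the rotation fields become a difference of two directional
  derivatives. This reduces all later index computations to inner products.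
\<close>

lemma angular_contraction:
  "(\<Sum>a\<in>UNIV. \<Sum>b\<in>UNIV. m $ a * n $ b * angular (a, b) w x)
     = (m \<bullet> x) * (\<Sum>a\<in>UNIV. n $ a * partial a w x) - (n \<bullet> x) * (\<Sum>a\<in>UNIV. m $ a * partial a w x)"
  by (simp add: angular_def inner_vec_def sum_3 algebra_simps)

lemma partial_angular:
  assumes "open G" "Ck_on 2 G w" "x \<in> G"
  shows "partial c (angular (a, b) w) x
     = axis c 1 $ a * partial b w x + x $ a * partial c (partial b w) x
       - (axis c 1 $ b * partial a w x + x $ b * partial c (partial a w) x)"
proof -
  have 1: "Ck_on (Suc 0) G (partial d w)" for d
    using assms(2) by (auto simp: numeral_2_eq_2 simp del: Ck_on.simps intro: Ck_on_partial)
  have "(angular (a, b) w has_derivative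
      (\<lambda>v. x $ a * frechet_derivative (partial b w) (at x) v + v $ a * partial b w x
         - (x $ b * frechet_derivative (partial a w) (at x) v + v $ b * partial a w x))) (at x)"
    unfolding angular_def prod.case
    by (intro has_derivative_diff has_derivative_mult Ck_on_Suc_has_derivative[OF 1 assms(3)]
        bounded_linear_imp_has_derivative bounded_linear_vec_nth)
  from frechet_derivative_at[OF this, symmetric] show ?thesis
    by (simp add: partial_def)
qed

text \<open>
  The two terms without second derivatives are the commutator of \<open>\<partial>\<close> with \<open>\<Omega>\<close>.
\<close>

lemma partial_angular_contraction:
  assumes "open G" "Ck_on 2 G w" "x \<in> G"
  defines "L \<equiv> \<lambda>m. \<Sum>a\<in>UNIV. m $ a * partial a w x"
    and "B \<equiv> \<lambda>m n. \<Sum>a\<in>UNIV. \<Sum>b\<in>UNIV. m $ a * n $ b * partial a (partial b w) x"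
  shows "(\<Sum>c\<in>UNIV. \<Sum>a\<in>UNIV. \<Sum>b\<in>UNIV. k $ c * m $ a * n $ b * partial c (angular (a, b) w) x)
     = (k \<bullet> m) * L n + (m \<bullet> x) * B k n - (k \<bullet> n) * L m - (n \<bullet> x) * B k m"
  unfolding partial_angular[OF assms(1-3)] L_def B_def
  by (simp add: inner_vec_def sum_3 axis_def algebra_simps)

text \<open>
  For a curve \<open>r \<omega>\<close> with \<open>\<bar>\<omega>\<bar> = 1\<close> and velocity \<open>c \<omega> + r \<eta>\<close>, the tangential part \<open>r \<eta>\<close>, although of size
  \<open>r\<close>, contributes rotations with bounded coefficients.
\<close>

lemma polar_first_derivative:
  fixes \<omega> \<eta> :: "real^3"
  assumes "\<omega> \<bullet> \<omega> = 1" "\<omega> \<bullet> \<eta> = 0"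
  shows "(\<Sum>a\<in>UNIV. (c *\<^sub>R \<omega> + r *\<^sub>R \<eta>) $ a * partial a w (r *\<^sub>R \<omega>))
     = c * (\<Sum>a\<in>UNIV. \<omega> $ a * partial a w (r *\<^sub>R \<omega>))
       + (\<Sum>a\<in>UNIV. \<Sum>b\<in>UNIV. \<omega> $ a * \<eta> $ b * angular (a, b) w (r *\<^sub>R \<omega>))"
  unfolding angular_contraction using assms
  by (simp add: inner_commute[of \<eta>] sum.distrib sum_distrib_left algebra_simps)

text \<open>
  The same for the second derivative, where \<open>\<zeta>\<close> stands for the second derivative of \<open>\<omega>\<close> and the third
  orthogonality relation comes from differentiating \<open>\<omega> \<bullet> \<eta> = 0\<close>. The
  mixed term \<open>2 c r\<close> times the Hessian at \<open>(\<omega>, \<eta>)\<close> has \<open>\<Omega>\<close> outside of \<open>\<partial>\<close>; symmetry of the Hessian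
  brings it to the form \<open>\<partial> \<Omega> w\<close>, and the commutator that this produces is exactly the term
  \<open>2 c \<eta>\<close> of the acceleration. The purely tangential Hessian is \<open>\<Omega> \<Omega> w\<close> up to a radial derivative
  with coefficient \<open>r \<bar>\<eta>\<bar>\<^sup>2\<close>, and this cancels the radial part of the acceleration \<open>r \<zeta>\<close>, whose tangential
  part is \<open>\<Omega> w\<close>. In the result no coefficient contains \<open>r\<close>.
\<close>

lemma polar_second_derivative:
  fixes \<omega> \<eta> \<zeta> :: "real^3" and c r :: real
  assumes "open G" "Ck_on 2 G w" "r *\<^sub>R \<omega> \<in> G"
    and on: "\<omega> \<bullet> \<omega> = 1" "\<omega> \<bullet> \<eta> = 0" "\<eta> \<bullet> \<eta> + \<omega> \<bullet> \<zeta> = 0"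
  defines "x \<equiv> r *\<^sub>R \<omega>" and "\<gamma>1 \<equiv> c *\<^sub>R \<omega> + r *\<^sub>R \<eta>" and "\<gamma>2 \<equiv> (2 * c) *\<^sub>R \<eta> + r *\<^sub>R \<zeta>"
  shows "(\<Sum>a\<in>UNIV. \<gamma>2 $ a * partial a w x) + (\<Sum>a\<in>UNIV. \<Sum>b\<in>UNIV. \<gamma>1 $ a * \<gamma>1 $ b * partial a (partial b w) x)
     = c * c * (\<Sum>a\<in>UNIV. \<Sum>b\<in>UNIV. \<omega> $ a * \<omega> $ b * partial a (partial b w) x)
     + 2 * c * (\<Sum>d\<in>UNIV. \<Sum>a\<in>UNIV. \<Sum>b\<in>UNIV. \<omega> $ d * \<omega> $ a * \<eta> $ b * partial d (angular (a, b) w) x)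
     + (\<Sum>a\<in>UNIV. \<Sum>b\<in>UNIV. \<omega> $ a * \<eta> $ b *
          (\<Sum>d\<in>UNIV. \<Sum>e\<in>UNIV. \<omega> $ d * \<eta> $ e * angular (d, e) (angular (a, b) w) x))
     + (\<Sum>a\<in>UNIV. \<Sum>b\<in>UNIV. \<omega> $ a * \<zeta> $ b * angular (a, b) w x)"
proof -
  define L where "L m = (\<Sum>a\<in>UNIV. m $ a * partial a w x)" for m :: "real^3"
  define B where "B m n = (\<Sum>a\<in>UNIV. \<Sum>b\<in>UNIV. m $ a * n $ b * partial a (partial b w) x)" for m n :: "real^3"
  have x: "open G" "Ck_on 2 G w" "x \<in> G" using assms by (auto simp: x_def)
  have L: "L (p *\<^sub>R m + q *\<^sub>R n) = p * L m + q * L n" for p q m n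
    by (simp add: L_def sum.distrib sum_distrib_left algebra_simps)
  have sym: "B m n = B n m" for m n
    unfolding B_def by (subst sum.swap) (simp add: partial_symmetric[OF x] mult.commute)
  have B: "B (p *\<^sub>R m + q *\<^sub>R n) k = p * B m k + q * B n k" for p q m n k
    by (simp add: B_def sum.distrib sum_distrib_left algebra_simps)
  have B': "B k (p *\<^sub>R m + q *\<^sub>R n) = p * B k m + q * B k n" for p q m n k
    by (simp add: B_def sum.distrib sum_distrib_left algebra_simps)
  have wz: "\<omega> \<bullet> \<zeta> = - (\<eta> \<bullet> \<eta>)"
    using on(3) by linarith
  have dots: "\<omega> \<bullet> x = r" "\<eta> \<bullet> x = 0" "\<zeta> \<bullet> x = - r * (\<eta> \<bullet> \<eta>)"
    using on(1,2) wz by (auto simp: x_def inner_commute)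
  have contract: "(\<Sum>d\<in>UNIV. \<Sum>a\<in>UNIV. \<Sum>b\<in>UNIV. k $ d * \<omega> $ a * \<eta> $ b * partial d (angular (a, b) w) x)
      = (k \<bullet> \<omega>) * L \<eta> + r * B k \<eta> - (k \<bullet> \<eta>) * L \<omega>" for k
    using partial_angular_contraction[OF x, of k \<omega> \<eta>] by (simp add: L_def B_def dots)
  have 3: "(\<Sum>a\<in>UNIV. \<Sum>b\<in>UNIV. \<omega> $ a * \<eta> $ b *
          (\<Sum>d\<in>UNIV. \<Sum>e\<in>UNIV. \<omega> $ d * \<eta> $ e * angular (d, e) (angular (a, b) w) x))
      = r * (r * B \<eta> \<eta> - (\<eta> \<bullet> \<eta>) * L \<omega>)" (is "?l = _")
  proof -
    have "?l = r * (\<Sum>a\<in>UNIV. \<Sum>b\<in>UNIV. \<Sum>d\<in>UNIV. \<eta> $ d * \<omega> $ a * \<eta> $ b * partial d (angular (a, b) w) x)"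
      unfolding angular_contraction dots
      by (simp add: sum_distrib_left ac_simps)
    also have "\<dots> = r * (\<Sum>a\<in>UNIV. \<Sum>d\<in>UNIV. \<Sum>b\<in>UNIV. \<eta> $ d * \<omega> $ a * \<eta> $ b * partial d (angular (a, b) w) x)"
      by (rule arg_cong[where f = "\<lambda>z. r * z"], rule sum.cong[OF refl], rule sum.swap)
    also have "\<dots> = r * (\<Sum>d\<in>UNIV. \<Sum>a\<in>UNIV. \<Sum>b\<in>UNIV. \<eta> $ d * \<omega> $ a * \<eta> $ b * partial d (angular (a, b) w) x)"
      by (rule arg_cong[where f = "\<lambda>z. r * z"], rule sum.swap)
    finally show ?thesis using on by (simp add: contract inner_commute)
  qed
  have 4: "(\<Sum>a\<in>UNIV. \<Sum>b\<in>UNIV. \<omega> $ a * \<zeta> $ b * angular (a, b) w x) = r * L \<zeta> + r * (\<eta> \<bullet> \<eta>) * L \<omega>"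
    unfolding angular_contraction dots by (simp add: L_def)
  have "L \<gamma>2 + B \<gamma>1 \<gamma>1 = 2 * c * L \<eta> + r * L \<zeta> + c * c * B \<omega> \<omega> + 2 * c * r * B \<omega> \<eta> + r * r * B \<eta> \<eta>"
    unfolding \<gamma>1_def \<gamma>2_def L B B' sym[of \<eta> \<omega>] by (simp add: algebra_simps)
  also have "\<dots> = c * c * B \<omega> \<omega> + 2 * c * (L \<eta> + r * B \<omega> \<eta>)
      + r * (r * B \<eta> \<eta> - (\<eta> \<bullet> \<eta>) * L \<omega>) + (r * L \<zeta> + r * (\<eta> \<bullet> \<eta>) * L \<omega>)"
    by (simp add: algebra_simps)
  finally show ?thesis
    unfolding contract 3 4 on by (simp add: L_def B_def)
qed

lemma has_vector_derivative_along_curve: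
  assumes "Ck_on (Suc k) G w" "\<gamma> t \<in> G" "(\<gamma> has_vector_derivative \<gamma>') (at t within T)"
  shows "((\<lambda>t. w (\<gamma> t)) has_vector_derivative (\<Sum>a\<in>UNIV. \<gamma>' $ a * partial a w (\<gamma> t))) (at t within T)"
proof -
  have "((\<lambda>t. w (\<gamma> t)) has_derivative (\<lambda>h. \<Sum>a\<in>UNIV. (h *\<^sub>R \<gamma>') $ a * partial a w (\<gamma> t))) (at t within T)"
    by (rule has_derivative_compose[where f = \<gamma> and g = w,
          OF assms(3)[unfolded has_vector_derivative_def] has_derivative_sum_partial[OF assms(1,2)]])
  then show ?thesis
    by (simp add: has_vector_derivative_def sum_distrib_left mult.assoc)
qed

lemma has_vector_derivative2_along_curve:
  assumes "Ck_on 2 G w" "\<gamma> t \<in> G"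
    "(\<gamma> has_vector_derivative \<gamma>1 t) (at t within T)" "(\<gamma>1 has_vector_derivative \<gamma>2) (at t within T)"
  shows "((\<lambda>t. \<Sum>a\<in>UNIV. \<gamma>1 t $ a * partial a w (\<gamma> t)) has_vector_derivative
     (\<Sum>a\<in>UNIV. \<gamma>2 $ a * partial a w (\<gamma> t))
       + (\<Sum>a\<in>UNIV. \<Sum>b\<in>UNIV. \<gamma>1 t $ a * \<gamma>1 t $ b * partial a (partial b w) (\<gamma> t))) (at t within T)"
proof -
  have 1: "Ck_on (Suc 0) G (partial b w)" for b
    using assms(1) by (auto simp: numeral_2_eq_2 simp del: Ck_on.simps intro: Ck_on_partial)
  have "((\<lambda>t. \<Sum>b\<in>UNIV. \<gamma>1 t $ b * partial b w (\<gamma> t)) has_vector_derivative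
     (\<Sum>b\<in>UNIV. \<gamma>1 t $ b * (\<Sum>a\<in>UNIV. \<gamma>1 t $ a * partial a (partial b w) (\<gamma> t))
        + \<gamma>2 $ b * partial b w (\<gamma> t))) (at t within T)"
    by (intro has_vector_derivative_sum has_vector_derivative_mult
        has_vector_derivative_along_curve[OF 1 assms(2,3)]
        bounded_linear.has_vector_derivative[OF bounded_linear_vec_nth assms(4)])
  moreover have "(\<Sum>b\<in>UNIV. \<gamma>1 t $ b * (\<Sum>a\<in>UNIV. \<gamma>1 t $ a * partial a (partial b w) (\<gamma> t))
        + \<gamma>2 $ b * partial b w (\<gamma> t))
     = (\<Sum>a\<in>UNIV. \<gamma>2 $ a * partial a w (\<gamma> t))
       + (\<Sum>b\<in>UNIV. \<Sum>a\<in>UNIV. \<gamma>1 t $ a * \<gamma>1 t $ b * partial a (partial b w) (\<gamma> t))"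
    by (simp add: sum.distrib sum_distrib_left ac_simps)
  moreover have "(\<Sum>b\<in>UNIV. \<Sum>a\<in>UNIV. \<gamma>1 t $ a * \<gamma>1 t $ b * partial a (partial b w) (\<gamma> t))
     = (\<Sum>a\<in>UNIV. \<Sum>b\<in>UNIV. \<gamma>1 t $ a * \<gamma>1 t $ b * partial a (partial b w) (\<gamma> t))"
    by (rule sum.swap)
  ultimately show ?thesis by simp
qed

section \<open>Taylor's formula in a polar chart\<close>

definition deriv_sum :: "(real^3 \<Rightarrow> real) \<Rightarrow> real^3 \<Rightarrow> real" where
  "deriv_sum v x = (\<Sum>(I, J)\<in>index_set. \<bar>foldr partial I (foldr angular J v) x\<bar>)"

lemma Ck_on_foldr_partial: "Ck_on (length I + k) G w \<Longrightarrow> Ck_on k G (foldr partial I w)"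
  by (induction I arbitrary: k)
    (auto simp del: Ck_on.simps add_Suc simp: add_Suc_shift intro!: Ck_on_partial)

lemma Ck_on_foldr_angular:
  assumes "open G"
  shows "Ck_on (length J + k) G w \<Longrightarrow> Ck_on k G (foldr angular J w)"
  by (induction J arbitrary: k)
    (auto simp del: Ck_on.simps add_Suc simp: add_Suc_shift intro!: Ck_on_angular assms)

lemma continuous_on_derivs:
  assumes "open G" "Ck_on 2 G v" "(I, J) \<in> index_set"
  shows "continuous_on G (foldr partial I (foldr angular J v))"
proof -
  have "length J + length I \<le> 2" using assms(3) by (simp add: index_set_def)
  then have "Ck_on (length J + length I) G v" using assms(2) by (rule Ck_on_mono)
  then have "Ck_on (length I + 0) G (foldr angular J v)"
    using Ck_on_foldr_angular[OF assms(1), of J "length I"] by simp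
  then show ?thesis using Ck_on_foldr_partial[of I 0] by simp
qed

lemma continuous_on_deriv_sum:
  assumes "open G" "Ck_on 2 G v"
  shows "continuous_on G (deriv_sum v)"
  unfolding deriv_sum_def[abs_def] using continuous_on_derivs[OF assms]
  by (auto simp: case_prod_beta intro!: continuous_on_sum continuous_on_rabs)

lemma le_deriv_sum:
  "\<bar>v x\<bar> \<le> deriv_sum v x" "\<bar>partial a v x\<bar> \<le> deriv_sum v x"
  "\<bar>partial a (partial b v) x\<bar> \<le> deriv_sum v x"
  "\<bar>angular p v x\<bar> \<le> deriv_sum v x" "\<bar>partial a (angular p v) x\<bar> \<le> deriv_sum v x"
  "\<bar>angular p (angular p' v) x\<bar> \<le> deriv_sum v x"
proof -
  have *: "\<bar>foldr partial I (foldr angular J v) x\<bar> \<le> deriv_sum v x"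
    if "length I + length J \<le> 2" for I J
    using member_le_sum[of "(I, J)" index_set "\<lambda>(I, J). \<bar>foldr partial I (foldr angular J v) x\<bar>"]
      that finite_index_set by (auto simp: deriv_sum_def index_set_def)
  show "\<bar>v x\<bar> \<le> deriv_sum v x" "\<bar>partial a v x\<bar> \<le> deriv_sum v x"
    "\<bar>partial a (partial b v) x\<bar> \<le> deriv_sum v x"
    "\<bar>angular p v x\<bar> \<le> deriv_sum v x" "\<bar>partial a (angular p v) x\<bar> \<le> deriv_sum v x"
    "\<bar>angular p (angular p' v) x\<bar> \<le> deriv_sum v x"
    using *[of "[]" "[]"] *[of "[a]" "[]"] *[of "[a, b]" "[]"] *[of "[]" "[p]"] *[of "[a]" "[p]"]
      *[of "[]" "[p, p']"] by auto
qed

lemma abs_sum_UNIV_3_le: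
  fixes z :: "3 \<Rightarrow> real"
  assumes "\<And>a. \<bar>k a\<bar> \<le> K" "\<And>a. \<bar>z a\<bar> \<le> M"
  shows "\<bar>\<Sum>a\<in>UNIV. k a * z a\<bar> \<le> 3 * (K * M)"
proof -
  have "norm (\<Sum>a\<in>(UNIV::3 set). k a * z a) \<le> real (card (UNIV::3 set)) * (K * M)"
  proof (rule sum_norm_bound)
    show "norm (k a * z a) \<le> K * M" for a
      unfolding real_norm_def abs_mult
      using assms[of a] order_trans[OF abs_ge_zero assms(1)[of a]] by (intro mult_mono) auto
  qed
  then show ?thesis by simp
qed

text \<open>
  The constant counts summands: 3 radial and 9 rotational ones.
\<close>

lemma polar_first_derivative_bound:
  fixes \<omega> \<eta> :: "real^3"
  assumes "\<omega> \<bullet> \<omega> = 1" "\<omega> \<bullet> \<eta> = 0" "\<eta> \<bullet> \<eta> \<le> 1" "\<bar>c\<bar> \<le> 1"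
  shows "\<bar>\<Sum>a\<in>UNIV. (c *\<^sub>R \<omega> + r *\<^sub>R \<eta>) $ a * partial a v (r *\<^sub>R \<omega>)\<bar> \<le> 12 * deriv_sum v (r *\<^sub>R \<omega>)"
proof -
  let ?M = "deriv_sum v (r *\<^sub>R \<omega>)"
  have w: "\<bar>\<omega> $ a\<bar> \<le> 1" and e: "\<bar>\<eta> $ a\<bar> \<le> 1" for a
    using component_le_norm_cart[of \<omega> a] component_le_norm_cart[of \<eta> a] assms
    by (auto simp: norm_eq_sqrt_inner intro: order_trans)
  have "\<bar>\<Sum>a\<in>UNIV. \<omega> $ a * partial a v (r *\<^sub>R \<omega>)\<bar> \<le> 3 * (1 * ?M)"
    by (intro abs_sum_UNIV_3_le w le_deriv_sum)
  then have "\<bar>c * (\<Sum>a\<in>UNIV. \<omega> $ a * partial a v (r *\<^sub>R \<omega>))\<bar> \<le> 1 * (3 * ?M)"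
    unfolding abs_mult using assms(4) by (intro mult_mono) auto
  moreover have "\<bar>\<Sum>a\<in>UNIV. \<omega> $ a * (\<Sum>b\<in>UNIV. \<eta> $ b * angular (a, b) v (r *\<^sub>R \<omega>))\<bar> \<le> 3 * (1 * (3 * (1 * ?M)))"
    by (intro abs_sum_UNIV_3_le w e le_deriv_sum)
  ultimately show ?thesis
    unfolding polar_first_derivative[OF assms(1,2)] by (simp add: sum_distrib_left mult.assoc)
qed

text \<open>
  Again the constant counts summands: \<open>9 + 2 \<cdot> 27 + 81 + 2 \<cdot> 9\<close>, where the last factor 2 is the bound
  for \<open>\<zeta>\<close>.
\<close>

lemma polar_second_derivative_bound:
  fixes \<omega> \<eta> \<zeta> :: "real^3" and c r :: real
  assumes "open G" "Ck_on 2 G v" "r *\<^sub>R \<omega> \<in> G"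
    and on: "\<omega> \<bullet> \<omega> = 1" "\<omega> \<bullet> \<eta> = 0" "\<eta> \<bullet> \<eta> + \<omega> \<bullet> \<zeta> = 0"
    and le: "\<eta> \<bullet> \<eta> \<le> 1" "\<zeta> \<bullet> \<zeta> \<le> 2\<^sup>2" "\<bar>c\<bar> \<le> 1"
  defines "x \<equiv> r *\<^sub>R \<omega>" and "\<gamma>1 \<equiv> c *\<^sub>R \<omega> + r *\<^sub>R \<eta>" and "\<gamma>2 \<equiv> (2 * c) *\<^sub>R \<eta> + r *\<^sub>R \<zeta>"
  shows "\<bar>(\<Sum>a\<in>UNIV. \<gamma>2 $ a * partial a v x) + (\<Sum>a\<in>UNIV. \<Sum>b\<in>UNIV. \<gamma>1 $ a * \<gamma>1 $ b * partial a (partial b v) x)\<bar>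
     \<le> 162 * deriv_sum v x"
proof -
  let ?M = "deriv_sum v x"
  have w: "\<bar>\<omega> $ a\<bar> \<le> 1" and e: "\<bar>\<eta> $ a\<bar> \<le> 1" for a
    using component_le_norm_cart[of \<omega> a] component_le_norm_cart[of \<eta> a] on le
    by (auto simp: norm_eq_sqrt_inner intro: order_trans)
  have z: "\<bar>\<zeta> $ a\<bar> \<le> 2" for a
    using component_le_norm_cart[of \<zeta> a] real_sqrt_le_mono[OF le(2)]
    by (auto simp: norm_eq_sqrt_inner intro: order_trans)
  have c2: "\<bar>c * c\<bar> \<le> 1" using le(3) abs_square_le_1[of c] by (simp add: power2_eq_square)
  have 1: "\<bar>\<Sum>a\<in>UNIV. \<omega> $ a * (\<Sum>b\<in>UNIV. \<omega> $ b * partial a (partial b v) x)\<bar> \<le> 3 * (1 * (3 * (1 * ?M)))"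
    by (intro abs_sum_UNIV_3_le w le_deriv_sum)
  have 2: "\<bar>\<Sum>d\<in>UNIV. \<omega> $ d * (\<Sum>a\<in>UNIV. \<omega> $ a * (\<Sum>b\<in>UNIV. \<eta> $ b * partial d (angular (a, b) v) x))\<bar>
      \<le> 3 * (1 * (3 * (1 * (3 * (1 * ?M)))))"
    by (intro abs_sum_UNIV_3_le w e le_deriv_sum)
  have 3: "\<bar>\<Sum>a\<in>UNIV. \<omega> $ a * (\<Sum>b\<in>UNIV. \<eta> $ b *
          (\<Sum>d\<in>UNIV. \<omega> $ d * (\<Sum>f\<in>UNIV. \<eta> $ f * angular (d, f) (angular (a, b) v) x)))\<bar>
      \<le> 3 * (1 * (3 * (1 * (3 * (1 * (3 * (1 * ?M)))))))"
    by (intro abs_sum_UNIV_3_le w e le_deriv_sum)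
  have 4: "\<bar>\<Sum>a\<in>UNIV. \<omega> $ a * (\<Sum>b\<in>UNIV. \<zeta> $ b * angular (a, b) v x)\<bar> \<le> 3 * (1 * (3 * (2 * ?M)))"
    by (intro abs_sum_UNIV_3_le w z le_deriv_sum)
  have first: "\<bar>c * c * (\<Sum>a\<in>UNIV. \<omega> $ a * (\<Sum>b\<in>UNIV. \<omega> $ b * partial a (partial b v) x))\<bar> \<le> 1 * (9 * ?M)"
    unfolding abs_mult[of "c * c"] using 1 c2 by (intro mult_mono) auto
  have second: "\<bar>2 * c * (\<Sum>d\<in>UNIV. \<omega> $ d * (\<Sum>a\<in>UNIV. \<omega> $ a * (\<Sum>b\<in>UNIV. \<eta> $ b * partial d (angular (a, b) v) x)))\<bar>
      \<le> 2 * (27 * ?M)"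
    unfolding abs_mult[of "2 * c"] using 2 le(3) by (intro mult_mono) auto
  show ?thesis
    unfolding x_def \<gamma>1_def \<gamma>2_def polar_second_derivative[OF assms(1-3) on]
    using first second 3 4 unfolding x_def
    by (simp add: sum_distrib_left mult.assoc)
qed



text \<open>
  The directions near the third axis, parametrised by their first two coordinates. In this
  parametrisation a ray through the origin of the parameter plane moves the first two coordinates
  at constant speed, which keeps the derivatives along rays simple. The third entry of the
  argument is reserved for the radial coordinate of the chart below.
\<close>

definition cap :: "real^3 \<Rightarrow> real^3" where
  "cap y = (y $ 1) *\<^sub>R axis 1 1 + (y $ 2) *\<^sub>R axis 2 1
     + sqrt (1 - ((y $ 1)\<^sup>2 + (y $ 2)\<^sup>2)) *\<^sub>R axis 3 1"

text \<open>
  Polar coordinates whose third axis has been turned by the orthogonal map \<open>f\<close> towards the point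
  under consideration. All radii occurring over the cube are at least \<open>r0\<close>, so the chart
  never leaves the exterior region, even when the base point lies on its boundary sphere.
\<close>

definition patch :: "(real^3 \<Rightarrow> real^3) \<Rightarrow> real \<Rightarrow> real^3 \<Rightarrow> real^3" where
  "patch f r0 y = (r0 + y $ 3) *\<^sub>R f (cap y)"

abbreviation patch_box :: "(real^3) set" where "patch_box \<equiv> cbox 0 (vec (1 / 2))"

lemma patch_box_bounds:
  assumes "y \<in> patch_box"
  shows "0 \<le> y $ a" "y $ a \<le> 1 / 2" "(y $ 1)\<^sup>2 + (y $ 2)\<^sup>2 \<le> 1 / 2"
proof -
  show *: "0 \<le> y $ a" "y $ a \<le> 1 / 2" for a using assms by (auto simp: mem_box_cart)
  have "(y $ a)\<^sup>2 \<le> (1 / 2)\<^sup>2" for a using * by (intro power_mono) auto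
  from this[of 1] this[of 2] show "(y $ 1)\<^sup>2 + (y $ 2)\<^sup>2 \<le> 1 / 2" by (simp add: power2_eq_square)
qed

lemma scaleR_patch_box:
  assumes "y \<in> patch_box" "0 \<le> t" "t \<le> 1"
  shows "t *\<^sub>R y \<in> patch_box"
proof -
  have "t * y $ a \<le> 1 * (1 / 2)" for a
    using patch_box_bounds(1,2)[OF assms(1), of a] assms(2,3) by (intro mult_mono)  auto
  moreover have "0 \<le> t * y $ a" for a
    using patch_box_bounds(1)[OF assms(1), of a] assms(2) by simp
  ultimately show ?thesis by (simp add: mem_box_cart)
qed

lemma inner_cap: "y \<in> patch_box \<Longrightarrow> cap y \<bullet> cap y = 1"
  using patch_box_bounds(3)[of y] by (simp add: cap_def inner_vec_def sum_3 axis_def power2_eq_square)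

lemma cap_scaleR: "cap (t *\<^sub>R y) = (t * y $ 1) *\<^sub>R axis 1 1 + (t * y $ 2) *\<^sub>R axis 2 1
     + sqrt (1 - t\<^sup>2 * ((y $ 1)\<^sup>2 + (y $ 2)\<^sup>2)) *\<^sub>R axis 3 1"
  by (simp add: cap_def power_mult_distrib algebra_simps)

lemma norm_patch:
  assumes "orthogonal_transformation f" "y \<in> patch_box" "0 \<le> r0"
  shows "norm (patch f r0 y) = r0 + y $ 3"
proof -
  have "norm (f (cap y)) = 1"
    using assms inner_cap[of y] by (simp add: orthogonal_transformation_def norm_eq_sqrt_inner)
  then show ?thesis using assms patch_box_bounds(1)[of y 3] by (simp add: patch_def)
qed

text \<open>
  The relations and bounds that the polar derivative formulas need. The edge length \<open>1 / 2\<close> of the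
  cube keeps the square root at least \<open>sqrt (1 / 2)\<close>, so the bounds do not degenerate.
\<close>

lemma cap_ray_derivatives:
  assumes "y \<in> patch_box" "0 \<le> t" "t \<le> 1"
  defines "q \<equiv> (y $ 1)\<^sup>2 + (y $ 2)\<^sup>2"
  defines "\<eta> \<equiv> \<lambda>t. (y $ 1) *\<^sub>R axis 1 1 + (y $ 2) *\<^sub>R axis 2 1 - (t * q / sqrt (1 - t\<^sup>2 * q)) *\<^sub>R axis 3 1 :: real^3"
    and "\<zeta> \<equiv> - (q / (sqrt (1 - t\<^sup>2 * q)) ^ 3) *\<^sub>R axis 3 1 :: real^3"
  shows "((\<lambda>t. cap (t *\<^sub>R y)) has_vector_derivative \<eta> t) (at t)"
    and "(\<eta> has_vector_derivative \<zeta>) (at t)"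
    and "cap (t *\<^sub>R y) \<bullet> \<eta> t = 0" "\<eta> t \<bullet> \<eta> t + cap (t *\<^sub>R y) \<bullet> \<zeta> = 0"
    and "\<eta> t \<bullet> \<eta> t \<le> 1" "\<zeta> \<bullet> \<zeta> \<le> 2\<^sup>2"
proof -
  have q: "0 \<le> q" "q \<le> 1 / 2" using patch_box_bounds(3)[OF assms(1)] by (auto simp: q_def)
  have "t\<^sup>2 \<le> 1" using assms by (simp add: power_le_one)
  then have "t\<^sup>2 * q \<le> 1 * (1 / 2)" using q by (intro mult_mono) auto
  then have p: "1 / 2 \<le> 1 - t\<^sup>2 * q" by simp
  define S where "S = sqrt (1 - t\<^sup>2 * q)"
  have S: "0 < S" "S\<^sup>2 = 1 - t\<^sup>2 * q" using p by (auto simp: S_def)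
  have sc: "((\<lambda>t. k t *\<^sub>R a) has_vector_derivative k' *\<^sub>R a) (at t)"
    if "(k has_real_derivative k') (at t)" for k k' and a :: "real^3"
    using has_vector_derivative_scaleR[OF that has_vector_derivative_const[of a]] by simp
  have dS: "((\<lambda>t. sqrt (1 - t\<^sup>2 * q)) has_real_derivative - (t * q / S)) (at t)"
  proof -
    have "((\<lambda>t. 1 - t\<^sup>2 * q) has_real_derivative - (2 * t * q)) (at t)"
      by (auto intro!: derivative_eq_intros)
    from DERIV_chain2[OF DERIV_real_sqrt this] p
    have "((\<lambda>t. sqrt (1 - t\<^sup>2 * q)) has_real_derivative inverse S / 2 * - (2 * t * q)) (at t)"
      by (simp add: S_def)
    then show ?thesis by (simp add: field_simps)
  qed
  show "((\<lambda>t. cap (t *\<^sub>R y)) has_vector_derivative \<eta> t) (at t)"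
  proof -
    have "((\<lambda>t. cap (t *\<^sub>R y)) has_vector_derivative
        (y $ 1) *\<^sub>R axis 1 1 + (y $ 2) *\<^sub>R axis 2 1 + (- (t * q / S)) *\<^sub>R axis 3 1) (at t)"
      unfolding cap_scaleR q_def[symmetric]
      by (intro has_vector_derivative_add sc dS) (auto intro!: derivative_eq_intros)
    then show ?thesis by (simp add: \<eta>_def S_def)
  qed
  have dq: "((\<lambda>t. t * q / sqrt (1 - t\<^sup>2 * q)) has_real_derivative q / S ^ 3) (at t)"
  proof -
    have "((\<lambda>t. t * q / sqrt (1 - t\<^sup>2 * q)) has_real_derivative
        (q * S - t * q * - (t * q / S)) / (S * S)) (at t)"
      using DERIV_divide[OF DERIV_cmult_right[OF DERIV_ident, of q] dS] S(1) by (simp add: S_def)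
    moreover have "(q * S - t * q * - (t * q / S)) / (S * S) = q * (S\<^sup>2 + t\<^sup>2 * q) / S ^ 3"
      using S(1) by (simp add: field_simps power2_eq_square power3_eq_cube)
    ultimately show ?thesis using S(2) by simp
  qed
  show "(\<eta> has_vector_derivative \<zeta>) (at t)"
  proof -
    have "(\<eta> has_vector_derivative 0 - (q / S ^ 3) *\<^sub>R axis 3 1) (at t)"
      unfolding \<eta>_def by (intro has_vector_derivative_diff has_vector_derivative_const sc dq)
    then show ?thesis by (simp add: \<zeta>_def S_def)
  qed
  show "cap (t *\<^sub>R y) \<bullet> \<eta> t = 0"
  proof -
    have "cap (t *\<^sub>R y) \<bullet> \<eta> t = t * q - S * (t * q / S)"
      unfolding cap_scaleR \<eta>_def q_def[symmetric] S_def[symmetric]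
      by (simp add: inner_vec_def sum_3 axis_def) (simp add: q_def power2_eq_square algebra_simps)
    then show ?thesis using S(1) by simp
  qed
  have ee: "\<eta> t \<bullet> \<eta> t = q + (t * q / S)\<^sup>2"
    unfolding \<eta>_def S_def[symmetric]
    by (simp add: inner_vec_def sum_3 axis_def q_def power2_eq_square)
  have "cap (t *\<^sub>R y) \<bullet> \<zeta> = - q / S\<^sup>2"
    unfolding cap_scaleR \<zeta>_def q_def[symmetric] S_def[symmetric] using S(1)
    by (simp add: inner_vec_def sum_3 axis_def power2_eq_square power3_eq_cube)
  moreover have "q + (t * q / S)\<^sup>2 = q * (S\<^sup>2 + t\<^sup>2 * q) / S\<^sup>2"
    using S(1) by (simp add: field_simps power2_eq_square)
  ultimately show "\<eta> t \<bullet> \<eta> t + cap (t *\<^sub>R y) \<bullet> \<zeta> = 0"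
    unfolding ee S(2) by simp
  have *: "q / S\<^sup>2 \<le> 1" using q p by (simp add: S(2) divide_simps)
  then show "\<eta> t \<bullet> \<eta> t \<le> 1"
    unfolding ee \<open>q + (t * q / S)\<^sup>2 = _\<close> by (simp add: S(2))
  have "(1 / 2)\<^sup>2 \<le> (1 / 2 :: real)" by (simp add: power2_eq_square)
  with p have "S \<ge> 1 / 2" unfolding S_def by (intro real_le_rsqrt) linarith
  have "q / S ^ 3 = (q / S\<^sup>2) * (1 / S)" by (simp add: power2_eq_square power3_eq_cube)
  also have "\<dots> \<le> 1 * 2" using * \<open>S \<ge> 1 / 2\<close> q by (intro mult_mono) (auto simp: divide_simps)
  finally have "(q / S ^ 3)\<^sup>2 \<le> 2\<^sup>2" using q S(1) by (intro power_mono) auto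
  then show "\<zeta> \<bullet> \<zeta> \<le> 2\<^sup>2"
    unfolding \<zeta>_def S_def[symmetric] by (simp add: inner_vec_def sum_3 axis_def power2_eq_square)
qed



text \<open>
  Taylor's formula along the ray from the base point to \<open>patch f r0 y\<close>, in the form
  \<open>g 0 = g 1 - g' 1 + \<integral> t g'' t\<close>, which evaluates first-order terms only at the far end.
  The substitution \<open>t = \<sigma>\<^sup>2\<close> turns the remainder into \<open>\<integral> 2 \<sigma>\<^sup>3 g'' (\<sigma>\<^sup>2)\<close>. After squaring, its weight
  \<open>\<sigma>\<^sup>6 = (\<sigma>\<^sup>2)\<^sup>3\<close> is precisely the Jacobian of the dilation by \<open>\<sigma>\<^sup>2\<close> in three dimensions.
  The constants are \<open>13 = 1 + 12\<close> and \<open>324 = 2 \<cdot> 162\<close>.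
\<close>

lemma radial_angular_taylor:
  assumes G: "open G" "Ck_on 2 G v" "{x. r0 \<le> norm x} \<subseteq> G" and "0 \<le> r0"
    and f: "orthogonal_transformation f" and y: "y \<in> patch_box"
  defines "F \<equiv> \<lambda>z. deriv_sum v (patch f r0 z)"
  shows "\<bar>v (patch f r0 0)\<bar> \<le> 13 * F y + integral {0..1} (\<lambda>\<sigma>. 324 * (\<sigma> ^ 3 * F (\<sigma>\<^sup>2 *\<^sub>R y)))"
proof -
  define q where "q = (y $ 1)\<^sup>2 + (y $ 2)\<^sup>2"
  define c where "c = y $ 3"
  define \<omega> where "\<omega> t = f (cap (t *\<^sub>R y))" for t
  define \<eta> where "\<eta> t = f ((y $ 1) *\<^sub>R axis 1 1 + (y $ 2) *\<^sub>R axis 2 1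
    - (t * q / sqrt (1 - t\<^sup>2 * q)) *\<^sub>R axis 3 1)" for t
  define \<zeta> where "\<zeta> t = f (- (q / (sqrt (1 - t\<^sup>2 * q)) ^ 3) *\<^sub>R axis 3 1)" for t
  define r where "r t = r0 + t * c" for t
  define \<gamma> where "\<gamma> t = patch f r0 (t *\<^sub>R y)" for t
  define \<gamma>1 where "\<gamma>1 t = c *\<^sub>R \<omega> t + r t *\<^sub>R \<eta> t" for t
  define \<gamma>2 where "\<gamma>2 t = (2 * c) *\<^sub>R \<eta> t + r t *\<^sub>R \<zeta> t" for t
  have \<gamma>_eq: "\<gamma> t = r t *\<^sub>R \<omega> t" for t
    by (simp add: \<gamma>_def patch_def r_def \<omega>_def c_def)
  have c: "\<bar>c\<bar> \<le> 1" using patch_box_bounds(1,2)[OF y, of 3] by (simp add: c_def)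
  have lin: "bounded_linear f"
    using f by (simp add: orthogonal_transformation_def linear_conv_bounded_linear)
  have iso: "f a \<bullet> f b = a \<bullet> b" for a b using f by (simp add: orthogonal_transformation_def)
  note ray = cap_ray_derivatives[OF y, folded q_def]
  have d\<omega>: "(\<omega> has_vector_derivative \<eta> t) (at t)" if "0 \<le> t" "t \<le> 1" for t
    using bounded_linear.has_vector_derivative[OF lin ray(1)[OF that]]
    by (simp add: \<omega>_def[abs_def] \<eta>_def)
  have d\<eta>: "(\<eta> has_vector_derivative \<zeta> t) (at t)" if "0 \<le> t" "t \<le> 1" for t
    using bounded_linear.has_vector_derivative[OF lin ray(2)[OF that]]
    by (simp add: \<eta>_def[abs_def] \<zeta>_def)
  have dr: "(r has_vector_derivative c) (at t)" for t
    unfolding r_def[abs_def] by (auto intro!: derivative_eq_intros)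
  have d\<gamma>: "(\<gamma> has_vector_derivative \<gamma>1 t) (at t)" if "0 \<le> t" "t \<le> 1" for t
    using has_vector_derivative_scaleR[OF dr[folded has_real_derivative_iff_has_vector_derivative] d\<omega>[OF that]]
    by (simp add: \<gamma>_eq[abs_def] \<gamma>1_def add.commute)
  have d\<gamma>1: "(\<gamma>1 has_vector_derivative \<gamma>2 t) (at t)" if "0 \<le> t" "t \<le> 1" for t
  proof -
    have "(\<gamma>1 has_vector_derivative c *\<^sub>R \<eta> t + (r t *\<^sub>R \<zeta> t + c *\<^sub>R \<eta> t)) (at t)"
      unfolding \<gamma>1_def[abs_def]
      by (intro has_vector_derivative_add d\<eta>[OF that]
          bounded_linear.has_vector_derivative[OF bounded_linear_scaleR_right d\<omega>[OF that]]
          has_vector_derivative_scaleR[OF dr[folded has_real_derivative_iff_has_vector_derivative] d\<eta>[OF that]])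
    moreover have "(2 * c) *\<^sub>R \<eta> t = c *\<^sub>R \<eta> t + c *\<^sub>R \<eta> t"
      by (simp flip: scaleR_add_left)
    ultimately show ?thesis by (simp add: \<gamma>2_def ac_simps)
  qed
  have on: "\<omega> t \<bullet> \<omega> t = 1" "\<omega> t \<bullet> \<eta> t = 0" "\<eta> t \<bullet> \<eta> t + \<omega> t \<bullet> \<zeta> t = 0"
    "\<eta> t \<bullet> \<eta> t \<le> 1" "\<zeta> t \<bullet> \<zeta> t \<le> 2\<^sup>2" if "0 \<le> t" "t \<le> 1" for t
    using ray(3-6)[OF that] inner_cap[OF scaleR_patch_box[OF y that]]
    unfolding \<omega>_def \<eta>_def \<zeta>_def iso by auto
  have patch_in: "patch f r0 z \<in> G" if "z \<in> patch_box" for z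
    using norm_patch[OF f that \<open>0 \<le> r0\<close>] patch_box_bounds(1)[OF that, of 3] G(3) by auto
  have inG: "\<gamma> t \<in> G" if "0 \<le> t" "t \<le> 1" for t
    unfolding \<gamma>_def by (rule patch_in[OF scaleR_patch_box[OF y that]])
  define g1 where "g1 t = (\<Sum>a\<in>UNIV. \<gamma>1 t $ a * partial a v (\<gamma> t))" for t
  define g2 where "g2 t = (\<Sum>a\<in>UNIV. \<gamma>2 t $ a * partial a v (\<gamma> t))
      + (\<Sum>a\<in>UNIV. \<Sum>b\<in>UNIV. \<gamma>1 t $ a * \<gamma>1 t $ b * partial a (partial b v) (\<gamma> t))" for t
  have dg: "((\<lambda>t. v (\<gamma> t)) has_real_derivative g1 t) (at t)" if "0 \<le> t" "t \<le> 1" for t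
    unfolding has_real_derivative_iff_has_vector_derivative g1_def
    by (rule has_vector_derivative_along_curve[OF G(2)[unfolded numeral_2_eq_2] inG[OF that] d\<gamma>[OF that]])
  have dg1: "(g1 has_real_derivative g2 t) (at t)" if "0 \<le> t" "t \<le> 1" for t
    unfolding has_real_derivative_iff_has_vector_derivative g1_def[abs_def] g2_def
    by (rule has_vector_derivative2_along_curve[OF G(2) inG[OF that] d\<gamma>[OF that] d\<gamma>1[OF that]])
  have g1_le: "\<bar>g1 t\<bar> \<le> 12 * F (t *\<^sub>R y)" if "0 \<le> t" "t \<le> 1" for t
    using polar_first_derivative_bound[OF on(1,2,4)[OF that] c, of "r t" v]
    by (simp add: g1_def F_def \<gamma>1_def \<gamma>_eq[symmetric]) (simp add: \<gamma>_def)
  have g2_le: "\<bar>g2 t\<bar> \<le> 162 * F (t *\<^sub>R y)" if "0 \<le> t" "t \<le> 1" for t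
    using polar_second_derivative_bound[OF G(1,2) inG[OF that, unfolded \<gamma>_eq] on[OF that] c]
    by (simp add: g2_def F_def \<gamma>1_def \<gamma>2_def \<gamma>_eq[symmetric]) (simp add: \<gamma>_def)
  \<comment> \<open>With \<open>g t = v (\<gamma> t)\<close>, the derivative of \<open>g t - t g' t\<close> is \<open>- t g'' t\<close>; here \<open>t = \<sigma>\<^sup>2\<close>.\<close>
  define h where "h \<sigma> = v (\<gamma> (\<sigma>\<^sup>2)) - \<sigma>\<^sup>2 * g1 (\<sigma>\<^sup>2)" for \<sigma>
  have dh: "(h has_vector_derivative - (2 * \<sigma> ^ 3 * g2 (\<sigma>\<^sup>2))) (at \<sigma> within {0..1})" if "\<sigma> \<in> {0..1}" for \<sigma>
  proof -
    have s: "0 \<le> \<sigma>\<^sup>2" "\<sigma>\<^sup>2 \<le> 1" using that by (auto intro: power_le_one)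
    have sq: "((\<lambda>\<sigma>. \<sigma>\<^sup>2) has_real_derivative 2 * \<sigma>) (at \<sigma>)"
      by (auto intro!: derivative_eq_intros)
    have "(h has_real_derivative g1 (\<sigma>\<^sup>2) * (2 * \<sigma>)
        - (2 * \<sigma> * g1 (\<sigma>\<^sup>2) + g2 (\<sigma>\<^sup>2) * (2 * \<sigma>) * \<sigma>\<^sup>2)) (at \<sigma>)"
      unfolding h_def[abs_def]
      by (intro DERIV_diff DERIV_mult sq DERIV_chain2[OF dg[OF s] sq] DERIV_chain2[OF dg1[OF s] sq])
    then show ?thesis
      by (auto simp: has_real_derivative_iff_has_vector_derivative[symmetric] power3_eq_cube
          power2_eq_square algebra_simps intro: has_field_derivative_at_within)
  qed
  have int: "((\<lambda>\<sigma>. - (2 * \<sigma> ^ 3 * g2 (\<sigma>\<^sup>2))) has_integral (h 1 - h 0)) {0..1}"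
    by (rule fundamental_theorem_of_calculus[OF _ dh]) auto
  have contF: "continuous_on patch_box F"
  proof -
    have "continuous_on patch_box (patch f r0)"
      unfolding patch_def[abs_def] cap_def
      by (intro continuous_intros bounded_linear.continuous_on[OF lin])
    then show ?thesis
      unfolding F_def using continuous_on_deriv_sum[OF G(1,2)] patch_in
      by (auto intro: continuous_on_compose2)
  qed
  have contF2: "continuous_on {0..1} (\<lambda>\<sigma>. F (\<sigma>\<^sup>2 *\<^sub>R y))"
    by (rule continuous_on_compose2[OF contF])
      (auto intro!: continuous_intros scaleR_patch_box[OF y] power_le_one)
  have "\<bar>h 1 - h 0\<bar> \<le> integral {0..1} (\<lambda>\<sigma>. 324 * (\<sigma> ^ 3 * F (\<sigma>\<^sup>2 *\<^sub>R y)))"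
    unfolding integral_unique[OF int, symmetric] real_norm_def[symmetric]
  proof (rule integral_norm_bound_integral)
    show "(\<lambda>\<sigma>. 324 * (\<sigma> ^ 3 * F (\<sigma>\<^sup>2 *\<^sub>R y))) integrable_on {0..1}"
      by (intro integrable_continuous_real continuous_intros contF2)
    show "norm (- (2 * \<sigma> ^ 3 * g2 (\<sigma>\<^sup>2))) \<le> 324 * (\<sigma> ^ 3 * F (\<sigma>\<^sup>2 *\<^sub>R y))" if "\<sigma> \<in> {0..1}" for \<sigma>
      using mult_left_mono[OF g2_le[of "\<sigma>\<^sup>2"], of "2 * \<sigma> ^ 3"] that
      by (simp add: abs_mult power_le_one)
  qed (use int in auto)
  moreover have "h 0 = v (patch f r0 0)" by (simp add: h_def \<gamma>_def)
  moreover have "\<bar>h 1\<bar> \<le> 13 * F y"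
    using g1_le[of 1] le_deriv_sum(1)[of v "\<gamma> 1"] by (simp add: h_def F_def \<gamma>_def)
  ultimately show ?thesis by linarith
qed

section \<open>Integration over the patch\<close>

lemma set_nn_integral_has_integral:
  fixes f :: "'a::euclidean_space \<Rightarrow> real"
  assumes "\<And>x. x \<in> A \<Longrightarrow> 0 \<le> f x" "(f has_integral i) A"
  shows "(\<integral>\<^sup>+x\<in>A. ennreal (f x) \<partial>lborel) = ennreal i"
proof -
  have "(\<integral>\<^sup>+x\<in>A. ennreal (f x) \<partial>lborel) = (\<integral>\<^sup>+x. ennreal (indicator A x * f x) \<partial>lborel)"
    by (rule nn_integral_cong) (simp split: split_indicator)
  then show ?thesis using nn_integral_has_integral_lebesgue[OF assms] by simp
qed

lemma square_integral_le:
  fixes g :: "real \<Rightarrow> real"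
  assumes "continuous_on {0..1} g"
  shows "(integral {0..1} g)\<^sup>2 \<le> integral {0..1} (\<lambda>t. (g t)\<^sup>2)"
proof -
  let ?m = "integral {0..1} g"
  have int: "g integrable_on {0..1}" "(\<lambda>t. (g t)\<^sup>2) integrable_on {0..1}"
    using assms by (auto intro!: integrable_continuous_real continuous_intros)
  have "0 \<le> integral {0..1} (\<lambda>t. (g t - ?m)\<^sup>2)"
    using assms by (intro integral_nonneg integrable_continuous_real continuous_intros) auto
  also have "(\<lambda>t. (g t - ?m)\<^sup>2) = (\<lambda>t. ((g t)\<^sup>2 - 2 * ?m * g t) + ?m\<^sup>2)"
    by (auto simp: power2_eq_square algebra_simps)
  also have "integral {0..1} \<dots> = integral {0..1} (\<lambda>t. (g t)\<^sup>2) - 2 * ?m * ?m + ?m\<^sup>2"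
  proof (rule integral_unique)
    have "((\<lambda>t. ((g t)\<^sup>2 - 2 * ?m * g t) + ?m\<^sup>2) has_integral
        (integral {0..1} (\<lambda>t. (g t)\<^sup>2) - 2 * ?m * ?m + measure lborel {0..1::real} *\<^sub>R ?m\<^sup>2)) {0..1}"
      by (intro has_integral_add has_integral_diff has_integral_mult_right has_integral_const_real
          integrable_integral int)
    then show "((\<lambda>t. ((g t)\<^sup>2 - 2 * ?m * g t) + ?m\<^sup>2) has_integral
        (integral {0..1} (\<lambda>t. (g t)\<^sup>2) - 2 * ?m * ?m + ?m\<^sup>2)) {0..1}"
      by simp
  qed
  finally show ?thesis by (simp add: power2_eq_square)
qed

lemma nn_integral_lborel_scaleR:
  fixes g :: "'a::euclidean_space \<Rightarrow> ennreal"
  assumes [measurable]: "g \<in> borel_measurable borel" and "0 < c"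
  shows "ennreal (c ^ DIM('a)) * (\<integral>\<^sup>+x. g (c *\<^sub>R x) \<partial>lborel) = (\<integral>\<^sup>+x. g x \<partial>lborel)"
proof -
  have "(\<integral>\<^sup>+x. g x \<partial>lborel)
      = (\<integral>\<^sup>+x. g x \<partial>density (distr lborel borel (\<lambda>x. 0 + c *\<^sub>R x)) (\<lambda>_. \<bar>c\<bar> ^ DIM('a)))"
    using lborel_affine[of c "0 :: 'a"] \<open>0 < c\<close> by simp
  also have "\<dots> = (\<integral>\<^sup>+x. ennreal (c ^ DIM('a)) * g (c *\<^sub>R x) \<partial>lborel)"
    using \<open>0 < c\<close> by (simp add: nn_integral_density nn_integral_distr)
  finally show ?thesis by (simp add: nn_integral_cmult)
qed

text \<open>
  A pointwise bound by values along the rays implies a bound by the mean: average over the cube and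
  exchange the integrals. For fixed \<open>\<sigma>\<close> the weight \<open>\<sigma>\<^sup>6\<close> compensates exactly the change of volume
  under \<open>y \<mapsto> \<sigma>\<^sup>2 y\<close>, so each \<open>\<sigma>\<close> contributes at most the full integral.
\<close>

lemma star_average:
  fixes P :: "real^3 \<Rightarrow> real"
  assumes cont: "continuous_on patch_box P" and nonneg: "\<And>y. y \<in> patch_box \<Longrightarrow> 0 \<le> P y"
    and le: "\<And>y. y \<in> patch_box \<Longrightarrow> A \<le> P y + integral {0..1} (\<lambda>\<sigma>. \<sigma> ^ 6 * P (\<sigma>\<^sup>2 *\<^sub>R y))"
  shows "ennreal A * emeasure lborel patch_box \<le> 2 * (\<integral>\<^sup>+y\<in>patch_box. ennreal (P y) \<partial>lborel)"
proof -
  define p where "p y = ennreal (P y) * indicator patch_box y" for y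
  have [measurable]: "p \<in> borel_measurable borel"
  proof -
    have "(\<lambda>y. ennreal (indicator patch_box y *\<^sub>R P y)) \<in> borel_measurable borel"
      using borel_measurable_continuous_on_indicator[OF _ cont] by auto
    moreover have "p = (\<lambda>y. ennreal (indicator patch_box y *\<^sub>R P y))"
      by (auto simp: p_def split: split_indicator)
    ultimately show ?thesis by simp
  qed
  define q where "q \<sigma> y = ennreal (\<sigma> ^ 6) * p (\<sigma>\<^sup>2 *\<^sub>R y) * indicator {0..1} \<sigma>" for \<sigma> :: real and y
  have [measurable]: "(\<lambda>(\<sigma>, y). q \<sigma> y) \<in> borel_measurable (borel \<Otimes>\<^sub>M borel)"
    unfolding q_def by measurable
  have pt: "ennreal A * indicator patch_box y \<le> p y + (\<integral>\<^sup>+\<sigma>. q \<sigma> y \<partial>lborel)" for y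
  proof (cases "y \<in> patch_box")
    case True
    have inQ: "\<sigma>\<^sup>2 *\<^sub>R y \<in> patch_box" if "\<sigma> \<in> {0..1}" for \<sigma>
      using that by (intro scaleR_patch_box[OF True]) (auto intro: power_le_one)
    have "continuous_on {0..1} (\<lambda>\<sigma>. P (\<sigma>\<^sup>2 *\<^sub>R y))"
      by (rule continuous_on_compose2[OF cont]) (use inQ in \<open>auto intro!: continuous_intros\<close>)
    then have "((\<lambda>\<sigma>. \<sigma> ^ 6 * P (\<sigma>\<^sup>2 *\<^sub>R y)) has_integral integral {0..1} (\<lambda>\<sigma>. \<sigma> ^ 6 * P (\<sigma>\<^sup>2 *\<^sub>R y))) {0..1}"
      by (intro integrable_integral integrable_continuous_real continuous_intros)
    then have "(\<integral>\<^sup>+\<sigma>\<in>{0..1}. ennreal (\<sigma> ^ 6 * P (\<sigma>\<^sup>2 *\<^sub>R y)) \<partial>lborel)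
        = ennreal (integral {0..1} (\<lambda>\<sigma>. \<sigma> ^ 6 * P (\<sigma>\<^sup>2 *\<^sub>R y)))"
      using nonneg[OF inQ] by (intro set_nn_integral_has_integral) auto
    moreover have "(\<integral>\<^sup>+\<sigma>\<in>{0..1}. ennreal (\<sigma> ^ 6 * P (\<sigma>\<^sup>2 *\<^sub>R y)) \<partial>lborel) = (\<integral>\<^sup>+\<sigma>. q \<sigma> y \<partial>lborel)"
      using inQ nonneg[OF inQ] by (intro nn_integral_cong) (auto simp: q_def p_def ennreal_mult split: split_indicator)
    ultimately have "(\<integral>\<^sup>+\<sigma>. q \<sigma> y \<partial>lborel) = ennreal (integral {0..1} (\<lambda>\<sigma>. \<sigma> ^ 6 * P (\<sigma>\<^sup>2 *\<^sub>R y)))"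
      by simp
    moreover have "0 \<le> integral {0..1} (\<lambda>\<sigma>. \<sigma> ^ 6 * P (\<sigma>\<^sup>2 *\<^sub>R y))"
      using nonneg[OF inQ] by (cases "(\<lambda>\<sigma>. \<sigma> ^ 6 * P (\<sigma>\<^sup>2 *\<^sub>R y)) integrable_on {0..1}")
        (auto intro!: integral_nonneg simp: not_integrable_integral)
    ultimately show ?thesis
      using True le[OF True] nonneg[OF True] by (simp add: p_def ennreal_leI flip: ennreal_plus)
  qed simp
  have "ennreal A * emeasure lborel patch_box = (\<integral>\<^sup>+y. ennreal A * indicator patch_box y \<partial>lborel)"
    by (simp add: nn_integral_cmult_indicator)
  also have "\<dots> \<le> (\<integral>\<^sup>+y. p y + (\<integral>\<^sup>+\<sigma>. q \<sigma> y \<partial>lborel) \<partial>lborel)"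
    by (intro nn_integral_mono pt)
  also have "\<dots> = (\<integral>\<^sup>+y. p y \<partial>lborel) + (\<integral>\<^sup>+y. \<integral>\<^sup>+\<sigma>. q \<sigma> y \<partial>lborel \<partial>lborel)"
    by (intro nn_integral_add) auto
  also have "(\<integral>\<^sup>+y. \<integral>\<^sup>+\<sigma>. q \<sigma> y \<partial>lborel \<partial>lborel) = (\<integral>\<^sup>+\<sigma>. \<integral>\<^sup>+y. q \<sigma> y \<partial>lborel \<partial>lborel)"
    by (rule lborel_pair.Fubini') simp
  also have "\<dots> \<le> (\<integral>\<^sup>+\<sigma>. (\<integral>\<^sup>+y. p y \<partial>lborel) * indicator {0..1::real} \<sigma> \<partial>lborel)"
  proof (rule nn_integral_mono)
    fix \<sigma> :: real
    show "(\<integral>\<^sup>+y. q \<sigma> y \<partial>lborel) \<le> (\<integral>\<^sup>+y. p y \<partial>lborel) * indicator {0..1} \<sigma>"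
    proof (cases "\<sigma> \<in> {0<..1}")
      case True
      then have "(\<integral>\<^sup>+y. q \<sigma> y \<partial>lborel) = ennreal ((\<sigma>\<^sup>2) ^ DIM(real^3)) * (\<integral>\<^sup>+y. p (\<sigma>\<^sup>2 *\<^sub>R y) \<partial>lborel)"
        by (simp add: q_def nn_integral_cmult flip: power_mult)
      also have "\<dots> = (\<integral>\<^sup>+y. p y \<partial>lborel)"
        using True by (intro nn_integral_lborel_scaleR) auto
      finally show ?thesis using True by simp
    next
      case False
      then show ?thesis by (cases "\<sigma> = 0") (auto simp: q_def split: split_indicator)
    qed
  qed
  also have "\<dots> = (\<integral>\<^sup>+y. p y \<partial>lborel)"
    by (simp add: nn_integral_cmult_indicator)
  finally show ?thesis by (simp add: p_def mult_2 add_mono)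
qed

text \<open>
  The change of variables theorem for functions into a Cartesian power, applied with exponent one.
\<close>

lemma absolutely_integrable_change_of_variables_real:
  fixes f :: "real^'m::{finite,wellorder} \<Rightarrow> real" and g :: "real^'m::_ \<Rightarrow> real^'m::_"
  assumes "S \<in> sets lebesgue" "\<And>x. x \<in> S \<Longrightarrow> (g has_derivative g' x) (at x within S)" "inj_on g S"
    and int: "(\<lambda>x. \<bar>det (matrix (g' x))\<bar> * f (g x)) absolutely_integrable_on S"
  shows "(f has_integral integral S (\<lambda>x. \<bar>det (matrix (g' x))\<bar> * f (g x))) (g ` S)"
proof -
  have "(\<lambda>x. \<bar>det (matrix (g' x))\<bar> *\<^sub>R (vec (f (g x)) :: real^1)) absolutely_integrable_on S"
    "integral S (\<lambda>x. \<bar>det (matrix (g' x))\<bar> *\<^sub>R (vec (f (g x)) :: real^1))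
       = vec (integral S (\<lambda>x. \<bar>det (matrix (g' x))\<bar> * f (g x)))"
    using int by (auto simp: absolutely_integrable_on_1_iff integral_on_1_eq)
  then have "(\<lambda>x. vec (f x) :: real^1) absolutely_integrable_on g ` S"
    "integral (g ` S) (\<lambda>x. vec (f x) :: real^1) = vec (integral S (\<lambda>x. \<bar>det (matrix (g' x))\<bar> * f (g x)))"
    using has_absolute_integral_change_of_variables[OF assms(1-3), of "\<lambda>x. vec (f x) :: real^1"] by blast+
  then show ?thesis
    by (auto simp: absolutely_integrable_on_1_iff integral_on_1_eq has_integral_iff
        set_lebesgue_integral_eq_integral(1))
qed

text \<open>
  The Jacobian of the chart is the square of the radius divided by the third coordinate of
  \<open>cap y\<close>, which is at most one; the radius is at least \<open>r0\<close>. The chart is injective since the norm of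
  a point determines the radial coordinate.
\<close>

lemma patch_change_of_variables:
  assumes f: "orthogonal_transformation f" and "0 < r0"
    and cont: "continuous_on {x. r0 \<le> norm x} P" and nonneg: "\<And>x. 0 \<le> P x"
  shows "ennreal (r0\<^sup>2) * (\<integral>\<^sup>+y\<in>patch_box. ennreal (P (patch f r0 y)) \<partial>lborel)
     \<le> (\<integral>\<^sup>+x\<in>{x. r0 \<le> norm x}. ennreal (P x) \<partial>lborel)"
proof -
  define S where "S y = sqrt (1 - ((y $ 1)\<^sup>2 + (y $ 2)\<^sup>2))" for y :: "real^3"
  have S: "0 < S y" "S y \<le> 1" "(S y)\<^sup>2 = 1 - ((y $ 1)\<^sup>2 + (y $ 2)\<^sup>2)" if "y \<in> patch_box" for y
    using patch_box_bounds(3)[OF that] by (auto simp: S_def)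
  define D where "D y k = (k $ 3) *\<^sub>R cap y + (r0 + y $ 3) *\<^sub>R ((k $ 1) *\<^sub>R axis 1 1 + (k $ 2) *\<^sub>R axis 2 1
      - ((y $ 1 * k $ 1 + y $ 2 * k $ 2) / S y) *\<^sub>R axis 3 1)" for y k :: "real^3"
  have lin: "bounded_linear f" "linear f"
    using f by (auto simp: orthogonal_transformation_def linear_conv_bounded_linear)
  have nth: "((\<lambda>y. y $ a) has_derivative (\<lambda>k. k $ a)) (at y within T)" for a and y :: "real^3" and T
    by (rule bounded_linear_imp_has_derivative[OF bounded_linear_vec_nth])
  have dS: "(S has_derivative (\<lambda>k. - ((y $ 1 * k $ 1 + y $ 2 * k $ 2) / S y))) (at y within patch_box)" if "y \<in> patch_box" for y
  proof -
    have "((\<lambda>y. 1 - ((y $ 1)\<^sup>2 + (y $ 2)\<^sup>2)) has_derivative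
        (\<lambda>k. - (2 * (y $ 1 * k $ 1 + y $ 2 * k $ 2)))) (at y within patch_box)"
      by (auto intro!: derivative_eq_intros nth simp: algebra_simps)
    from has_derivative_real_sqrt[OF _ this] S(1)[OF that]
    have "(S has_derivative (\<lambda>k. - (2 * (y $ 1 * k $ 1 + y $ 2 * k $ 2)) * (inverse (S y) / 2))) (at y within patch_box)"
      by (simp add: S_def[abs_def])
    moreover have "- (2 * a) * (inverse b / 2) = - (a / b)" for a b :: real
      by (cases "b = 0") (simp_all add: field_simps)
    ultimately show ?thesis by (simp only:)
  qed
  have der: "(patch f r0 has_derivative (\<lambda>k. f (D y k))) (at y within patch_box)" if "y \<in> patch_box" for y
  proof -
    have dcap: "(cap has_derivative (\<lambda>k. (k $ 1) *\<^sub>R axis 1 1 + (k $ 2) *\<^sub>R axis 2 1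
      + (- ((y $ 1 * k $ 1 + y $ 2 * k $ 2) / S y)) *\<^sub>R axis 3 1)) (at y within patch_box)"
      unfolding cap_def[abs_def] S_def[symmetric]
      by (intro has_derivative_add has_derivative_scaleR_left nth dS[OF that])
    have "((\<lambda>y. (r0 + y $ 3) *\<^sub>R cap y) has_derivative D y) (at y within patch_box)"
      by (rule has_derivative_eq_rhs[OF has_derivative_scaleR[OF has_derivative_add[OF has_derivative_const nth] dcap]])
        (simp add: D_def fun_eq_iff add.commute)
    from bounded_linear.has_derivative[OF lin(1) this] show ?thesis
      by (simp add: patch_def[abs_def] linear_scale[OF lin(2)])
  qed
  have linD: "linear (D y)" for y
    by (rule linearI) (simp_all add: D_def algebra_simps add_divide_distrib)
  have "det (matrix (D y)) = (r0 + y $ 3)\<^sup>2 * ((S y)\<^sup>2 + ((y $ 1)\<^sup>2 + (y $ 2)\<^sup>2)) / S y" if "y \<in> patch_box" for y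
    using S(1)[OF that]
    by (simp add: det_3 matrix_def D_def cap_def S_def[symmetric] axis_def)
      (simp add: field_simps power2_eq_square)
  then have det: "\<bar>det (matrix (\<lambda>k. f (D y k)))\<bar> = (r0 + y $ 3)\<^sup>2 / S y" if "y \<in> patch_box" for y
    using S[OF that] matrix_compose[OF linD[of y] lin(2)] orthogonal_transformation_det[OF f] that
    by (simp add: o_def det_mul abs_mult)
  have inj: "inj_on (patch f r0) patch_box"
  proof (rule inj_onI)
    fix y z assume yz: "y \<in> patch_box" "z \<in> patch_box" "patch f r0 y = patch f r0 z"
    then have 3: "y $ 3 = z $ 3"
      using norm_patch[OF f yz(1), of r0] norm_patch[OF f yz(2), of r0] \<open>0 < r0\<close> by simp
    moreover have "0 < r0 + z $ 3" using patch_box_bounds(1)[OF yz(2), of 3] \<open>0 < r0\<close> by simp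
    ultimately have "f (cap y) = f (cap z)" using yz(3) by (simp add: patch_def)
    then have "cap y = cap z"
      using orthogonal_transformation_inj[OF f] by (simp add: inj_def)
    then have "cap y $ 1 = cap z $ 1" "cap y $ 2 = cap z $ 2" by auto
    then have "y $ 1 = z $ 1" "y $ 2 = z $ 2" by (auto simp: cap_def axis_def)
    with 3 show "y = z" by (simp add: vec_eq_iff forall_3)
  qed
  have image: "patch f r0 ` patch_box \<subseteq> {x. r0 \<le> norm x}"
    using norm_patch[OF f, of _ r0] patch_box_bounds(1)[of _ 3] \<open>0 < r0\<close> by auto
  have contP: "continuous_on patch_box (\<lambda>y. P (patch f r0 y))"
    by (rule continuous_on_compose2[OF cont _ image])
      (rule has_derivative_continuous_on[OF der])
  have contS: "continuous_on patch_box S" unfolding S_def[abs_def] by (intro continuous_intros)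
  have cont': "continuous_on patch_box (\<lambda>y. (r0 + y $ 3)\<^sup>2 / S y * P (patch f r0 y))"
    using S(1) by (intro continuous_intros contP contS) (metis less_irrefl)
  have "(\<lambda>y. \<bar>det (matrix (\<lambda>k. f (D y k)))\<bar> * P (patch f r0 y)) absolutely_integrable_on patch_box"
    using cont' by (intro absolutely_integrable_continuous) (simp add: det cong: continuous_on_cong)
  from absolutely_integrable_change_of_variables_real[OF _ der inj this]
  have I: "(P has_integral integral patch_box (\<lambda>y. \<bar>det (matrix (\<lambda>k. f (D y k)))\<bar> * P (patch f r0 y))) (patch f r0 ` patch_box)"
    by simp
  have le: "r0\<^sup>2 * P (patch f r0 y) \<le> \<bar>det (matrix (\<lambda>k. f (D y k)))\<bar> * P (patch f r0 y)" if "y \<in> patch_box" for y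
  proof (rule mult_right_mono[OF _ nonneg])
    have "r0\<^sup>2 / 1 \<le> (r0 + y $ 3)\<^sup>2 / S y"
      using S(1,2)[OF that] patch_box_bounds(1)[OF that, of 3] \<open>0 < r0\<close> by (intro frac_le power_mono) auto
    then show "r0\<^sup>2 \<le> \<bar>det (matrix (\<lambda>k. f (D y k)))\<bar>" by (simp add: det[OF that])
  qed
  have "ennreal (r0\<^sup>2) * (\<integral>\<^sup>+y\<in>patch_box. ennreal (P (patch f r0 y)) \<partial>lborel)
      = ennreal (r0\<^sup>2) * ennreal (integral patch_box (\<lambda>y. P (patch f r0 y)))"
    using nonneg contP
    by (subst set_nn_integral_has_integral[OF _ integrable_integral]) (auto intro: integrable_continuous)
  also have "\<dots> = ennreal (integral patch_box (\<lambda>y. r0\<^sup>2 * P (patch f r0 y)))"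
    using nonneg contP by (simp add: ennreal_mult integral_nonneg integrable_continuous)
  also have "\<dots> \<le> ennreal (integral patch_box (\<lambda>y. \<bar>det (matrix (\<lambda>k. f (D y k)))\<bar> * P (patch f r0 y)))"
    using contP cont' le
    by (intro ennreal_leI integral_le integrable_continuous)
      (auto simp: det intro!: continuous_intros cong: continuous_on_cong)
  also have "\<dots> = (\<integral>\<^sup>+x\<in>patch f r0 ` patch_box. ennreal (P x) \<partial>lborel)"
    using nonneg by (intro set_nn_integral_has_integral[symmetric] I)
  also have "\<dots> \<le> (\<integral>\<^sup>+x\<in>{x. r0 \<le> norm x}. ennreal (P x) \<partial>lborel)"
    using image by (intro nn_integral_mono mult_left_mono) (auto split: split_indicator)
  finally show ?thesis .
qed

section \<open>The estimate on the exterior of a ball\<close>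

text \<open>
  The convention of \<open>L2_slice\<close>, for functions of the spatial variable alone.
\<close>

definition L2_on :: "(real^3) set \<Rightarrow> (real^3 \<Rightarrow> real) \<Rightarrow> ennreal" where
  "L2_on A w =
     (let I = (\<integral>\<^sup>+ x \<in> A. ennreal (\<bar>w x\<bar>\<^sup>2) \<partial>lborel)
      in if I = \<infinity> then \<infinity> else ennreal (sqrt (enn2real I)))"

lemma emeasure_patch_box: "emeasure lborel patch_box = ennreal (1 / 8)"
proof -
  have "measure lborel patch_box = (\<Prod>i\<in>(UNIV :: 3 set). 1 / 2)"
    by (subst content_cbox_cart) (auto simp: interval_ne_empty_cart)
  then have "measure lborel patch_box = 1 / 8" by (simp add: power3_eq_cube)
  moreover have "emeasure lborel patch_box \<noteq> top"
    using emeasure_lborel_cbox_finite[of 0 "vec (1 / 2) :: real^3"] by auto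
  ultimately show ?thesis by (metis emeasure_eq_ennreal_measure)
qed

lemma square_deriv_sum_le:
  "(deriv_sum v x)\<^sup>2 \<le> real (card index_set) * (\<Sum>(I, J)\<in>index_set. \<bar>foldr partial I (foldr angular J v) x\<bar>\<^sup>2)"
proof -
  have "(deriv_sum v x)\<^sup>2 \<le> (\<Sum>(I, J)\<in>index_set. \<bar>foldr partial I (foldr angular J v) x\<bar>\<^sup>2) * card index_set"
    unfolding deriv_sum_def case_prod_beta by (rule sum_squared_le_sum_of_squares)
  then show ?thesis by (simp add: mult.commute)
qed

text \<open>
  Taylor's formula gives the pointwise bound required for averaging. Then the average over the cube
  is transported to the exterior region, where the Jacobian supplies the weight \<open>(norm x0)\<^sup>2\<close>.
\<close>

lemma exterior_estimate_squared:
  assumes G: "open G" "Ck_on 2 G v" "{x. norm x0 \<le> norm x} \<subseteq> G" and "x0 \<noteq> 0"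
  shows "ennreal ((norm x0)\<^sup>2 * \<bar>v x0\<bar>\<^sup>2)
     \<le> ennreal (4000000 * real (card index_set)) * (\<Sum>(I, J)\<in>index_set.
         \<integral>\<^sup>+ x \<in> {x. norm x0 \<le> norm x}. ennreal (\<bar>foldr partial I (foldr angular J v) x\<bar>\<^sup>2) \<partial>lborel)"
proof -
  define r0 where "r0 = norm x0"
  have r0: "0 < r0" using assms(4) by (simp add: r0_def)
  have "norm (r0 *\<^sub>R axis (3 :: 3) (1 :: real)) = norm x0"
    using r0 by (simp add: r0_def)
  then obtain f where f: "orthogonal_transformation f" and fe: "f (r0 *\<^sub>R axis (3 :: 3) (1 :: real)) = x0"
    by (rule orthogonal_transformation_exists) (rule that)
  have lin: "linear f" using f by (simp add: orthogonal_transformation_def)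
  have "patch f r0 0 = x0"
    using fe by (simp add: patch_def cap_def linear_scale[OF lin])
  define P where "P x = (deriv_sum v x)\<^sup>2" for x
  have G': "{x. r0 \<le> norm x} \<subseteq> G" using G(3) by (simp add: r0_def)
  have contP: "continuous_on {x. r0 \<le> norm x} P"
    unfolding P_def[abs_def]
    by (intro continuous_intros continuous_on_subset[OF continuous_on_deriv_sum[OF G(1,2)] G'])
  have inext: "patch f r0 y \<in> {x. r0 \<le> norm x}" if "y \<in> patch_box" for y
    using norm_patch[OF f that, of r0] patch_box_bounds(1)[OF that, of 3] r0 by simp
  have "continuous_on patch_box (cap :: real^3 \<Rightarrow> _)"
    unfolding cap_def[abs_def] by (intro continuous_intros)
  then have "continuous_on patch_box (patch f r0)"
    unfolding patch_def[abs_def]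
    by (intro continuous_on_scaleR continuous_on_add continuous_on_const continuous_on_component
        continuous_on_id linear_continuous_on_compose[OF _ lin])
  then have contPp: "continuous_on patch_box (\<lambda>y. P (patch f r0 y))"
    by (rule continuous_on_compose2[OF contP]) (use inext in blast)
  have contFp: "continuous_on patch_box (\<lambda>y. deriv_sum v (patch f r0 y))"
    by (rule continuous_on_compose2[OF continuous_on_deriv_sum[OF G(1,2)] \<open>continuous_on patch_box (patch f r0)\<close>])
      (use inext G' in blast)
  \<comment> \<open>The number \<open>209952 = 2 \<cdot> 324\<^sup>2\<close> comes from squaring a sum of two terms.\<close>
  have pt: "\<bar>v x0\<bar>\<^sup>2 / 209952 \<le> P (patch f r0 y) + integral {0..1} (\<lambda>\<sigma>. \<sigma> ^ 6 * P (patch f r0 (\<sigma>\<^sup>2 *\<^sub>R y)))"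
    if y: "y \<in> patch_box" for y
  proof -
    let ?F = "deriv_sum v (patch f r0 y)"
    let ?I = "integral {0..1} (\<lambda>\<sigma>. \<sigma> ^ 3 * deriv_sum v (patch f r0 (\<sigma>\<^sup>2 *\<^sub>R y)))"
    have cont: "continuous_on {0..1} (\<lambda>\<sigma>. \<sigma> ^ 3 * deriv_sum v (patch f r0 (\<sigma>\<^sup>2 *\<^sub>R y)))"
      by (intro continuous_on_mult continuous_on_power continuous_on_id
          continuous_on_compose2[OF contFp] continuous_on_scaleR continuous_on_const)
        (auto intro!: scaleR_patch_box[OF y] power_le_one)
    have "\<bar>v x0\<bar> \<le> 13 * ?F + 324 * ?I"
      using radial_angular_taylor[OF G(1,2) G' less_imp_le[OF r0] f y] \<open>patch f r0 0 = x0\<close> by simp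
    then have "\<bar>v x0\<bar>\<^sup>2 \<le> (13 * ?F + 324 * ?I)\<^sup>2" by (intro power_mono) auto
    also have "\<dots> \<le> 2 * (13 * ?F)\<^sup>2 + 2 * (324 * ?I)\<^sup>2"
      using sum_squares_bound[of "13 * ?F" "324 * ?I"] by (simp add: power2_sum)
    also have "\<dots> \<le> 209952 * (?F\<^sup>2 + ?I\<^sup>2)" by (simp add: power_mult_distrib)
    also have "?I\<^sup>2 \<le> integral {0..1} (\<lambda>\<sigma>. (\<sigma> ^ 3 * deriv_sum v (patch f r0 (\<sigma>\<^sup>2 *\<^sub>R y)))\<^sup>2)"
      by (rule square_integral_le[OF cont])
    finally show ?thesis
      by (simp add: P_def power_mult_distrib flip: power_mult)
  qed
  let ?S = "\<Sum>(I, J)\<in>index_set.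
      \<integral>\<^sup>+ x \<in> {x. r0 \<le> norm x}. ennreal (\<bar>foldr partial I (foldr angular J v) x\<bar>\<^sup>2) \<partial>lborel"
  have "(\<integral>\<^sup>+x\<in>{x. r0 \<le> norm x}. ennreal (P x) \<partial>lborel)
      \<le> (\<integral>\<^sup>+x. ennreal (card index_set) * (\<Sum>(I, J)\<in>index_set.
           ennreal (\<bar>foldr partial I (foldr angular J v) x\<bar>\<^sup>2) * indicator {x. r0 \<le> norm x} x) \<partial>lborel)"
  proof (rule nn_integral_mono)
    fix x
    have "ennreal (P x) \<le> ennreal (card index_set) * (\<Sum>(I, J)\<in>index_set. ennreal (\<bar>foldr partial I (foldr angular J v) x\<bar>\<^sup>2))"
      using ennreal_leI[OF square_deriv_sum_le[of v x]]
      by (simp add: P_def ennreal_mult sum_nonneg case_prod_beta flip: sum_ennreal)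
    then show "ennreal (P x) * indicator {x. r0 \<le> norm x} x \<le> ennreal (card index_set) * (\<Sum>(I, J)\<in>index_set.
           ennreal (\<bar>foldr partial I (foldr angular J v) x\<bar>\<^sup>2) * indicator {x. r0 \<le> norm x} x)"
      by (auto split: split_indicator)
  qed
  also have "\<dots> = ennreal (card index_set) * (\<Sum>(I, J)\<in>index_set.
      \<integral>\<^sup>+ x \<in> {x. r0 \<le> norm x}. ennreal (\<bar>foldr partial I (foldr angular J v) x\<bar>\<^sup>2) \<partial>lborel)"
  proof -
    have meas: "(\<lambda>x. ennreal (\<bar>foldr partial I (foldr angular J v) x\<bar>\<^sup>2) * indicator {x. r0 \<le> norm x} x) \<in> borel_measurable lborel"
      if "(I, J) \<in> index_set" for I J
    proof -
      let ?A = "{x :: real^3. r0 \<le> norm x}"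
      have "closed ?A" by (intro closed_Collect_le continuous_intros)
      then have "(\<lambda>x. ennreal ((indicator ?A x *\<^sub>R foldr partial I (foldr angular J v) x)\<^sup>2)) \<in> borel_measurable borel"
        using borel_measurable_continuous_on_indicator[OF _ continuous_on_subset[OF continuous_on_derivs[OF G(1,2) that] G']]
        by (auto intro!: borel_measurable_power)
      moreover have "(\<lambda>x. ennreal (\<bar>foldr partial I (foldr angular J v) x\<bar>\<^sup>2) * indicator ?A x)
          = (\<lambda>x. ennreal ((indicator ?A x *\<^sub>R foldr partial I (foldr angular J v) x)\<^sup>2))"
        by (auto split: split_indicator)
      ultimately show ?thesis by simp
    qed
    have "(\<lambda>x. ennreal (\<bar>foldr partial (fst \<alpha>) (foldr angular (snd \<alpha>) v) x\<bar>\<^sup>2) * indicator {x. r0 \<le> norm x} x)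
        \<in> borel_measurable lborel" if "\<alpha> \<in> index_set" for \<alpha>
      using meas[of "fst \<alpha>" "snd \<alpha>"] that by simp
    then show ?thesis
      unfolding case_prod_beta
      by (subst nn_integral_cmult[OF borel_measurable_sum], assumption) (subst nn_integral_sum, auto)
  qed
  finally have dom: "(\<integral>\<^sup>+x\<in>{x. r0 \<le> norm x}. ennreal (P x) \<partial>lborel) \<le> ennreal (card index_set) * ?S" .
  have "ennreal (\<bar>v x0\<bar>\<^sup>2 / 209952) * emeasure lborel patch_box \<le> 2 * (\<integral>\<^sup>+y\<in>patch_box. ennreal (P (patch f r0 y)) \<partial>lborel)"
    by (rule star_average[OF contPp _ pt]) (simp_all add: P_def)
  then have "ennreal (r0\<^sup>2) * (ennreal (\<bar>v x0\<bar>\<^sup>2 / 209952) * emeasure lborel patch_box)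
      \<le> ennreal (r0\<^sup>2) * (2 * (\<integral>\<^sup>+y\<in>patch_box. ennreal (P (patch f r0 y)) \<partial>lborel))"
    by (rule mult_left_mono) simp
  also have "\<dots> = 2 * (ennreal (r0\<^sup>2) * (\<integral>\<^sup>+y\<in>patch_box. ennreal (P (patch f r0 y)) \<partial>lborel))"
    by (simp add: ac_simps)
  also have "\<dots> \<le> 2 * (\<integral>\<^sup>+x\<in>{x. r0 \<le> norm x}. ennreal (P x) \<partial>lborel)"
    by (intro mult_left_mono patch_change_of_variables[OF f r0 contP]) (simp_all add: P_def)
  also have "\<dots> \<le> 2 * (ennreal (card index_set) * ?S)"
    by (intro mult_left_mono dom) simp
  finally have "ennreal (r0\<^sup>2) * (ennreal (\<bar>v x0\<bar>\<^sup>2 / 209952) * ennreal (1 / 8))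
      \<le> 2 * (ennreal (card index_set) * ?S)"
    by (simp add: emeasure_patch_box)
  \<comment> \<open>Clear denominators: \<open>1679616 = 8 \<cdot> 209952\<close>, and twice this number is below \<open>4000000\<close>.\<close>
  then have "ennreal 1679616 * (ennreal (r0\<^sup>2) * (ennreal (\<bar>v x0\<bar>\<^sup>2 / 209952) * ennreal (1 / 8)))
     \<le> ennreal 1679616 * (2 * (ennreal (card index_set) * ?S))"
    by (rule mult_left_mono) simp
  moreover have "ennreal 1679616 * (ennreal (r0\<^sup>2) * (ennreal (\<bar>v x0\<bar>\<^sup>2 / 209952) * ennreal (1 / 8)))
      = ennreal (r0\<^sup>2 * \<bar>v x0\<bar>\<^sup>2)"
    by (simp del: ennreal_numeral flip: ennreal_mult)
  moreover have "ennreal 1679616 * (2 * (ennreal (card index_set) * ?S)) = ennreal (3359232 * card index_set) * ?S"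
    by (simp add: ennreal_mult mult.assoc[symmetric])
  moreover have "\<dots> \<le> ennreal (4000000 * card index_set) * ?S"
    by (intro mult_right_mono ennreal_leI) auto
  ultimately show ?thesis by (simp add: r0_def)
qed

text \<open>
  The factor is twice the square root of the number in the squared estimate; the 2 comes from
  passing to \<open>1 + norm x\<close>.
\<close>

definition sobolev_const :: real where
  "sobolev_const = 4000 * sqrt (real (card index_set))"

lemma sobolev_const_pos: "0 < sobolev_const"
proof -
  have "([], []) \<in> index_set" by (simp add: index_set_def)
  then have "0 < card index_set" using finite_index_set by (auto simp: card_gt_0_iff)
  then show ?thesis by (simp add: sobolev_const_def)
qed

text \<open>
  The hypothesis \<open>1 \<le> R\<close> makes \<open>1 / \<bar>x\<^sub>0\<bar>\<close> comparable to \<open>1 / (1 + \<bar>x\<^sub>0\<bar>)\<close>. If some norm is infinite, so is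
  the right-hand side.
\<close>

lemma exterior_estimate:
  assumes G: "open G" "Ck_on 2 G v" "{x. R \<le> norm x} \<subseteq> G" and R: "1 \<le> R" "R \<le> norm x0"
  shows "ennreal \<bar>v x0\<bar> \<le> ennreal (sobolev_const * inverse (1 + norm x0))
     * (\<Sum>(I, J)\<in>index_set. L2_on {x. R \<le> norm x} (foldr partial I (foldr angular J v)))"
proof -
  define N where "N = (\<lambda>(I, J). \<integral>\<^sup>+ x \<in> {x. R \<le> norm x}. ennreal (\<bar>foldr partial I (foldr angular J v) x\<bar>\<^sup>2) \<partial>lborel)"
  have L2: "L2_on {x. R \<le> norm x} (foldr partial I (foldr angular J v))
      = (if N (I, J) = \<infinity> then \<infinity> else ennreal (sqrt (enn2real (N (I, J)))))" for I J
    by (simp add: L2_on_def N_def Let_def)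
  let ?K = "sobolev_const * inverse (1 + norm x0)"
  have K: "0 < ?K" using sobolev_const_pos by (simp add: add_pos_nonneg)
  show ?thesis
  proof (cases "\<exists>\<alpha>\<in>index_set. N \<alpha> = \<infinity>")
    case True
    then obtain I J where IJ: "(I, J) \<in> index_set" "N (I, J) = \<infinity>" by auto
    then have "(case (I, J) of (I, J) \<Rightarrow> L2_on {x. R \<le> norm x} (foldr partial I (foldr angular J v))) = top"
      using L2 by simp
    then have "(\<Sum>(I, J)\<in>index_set. L2_on {x. R \<le> norm x} (foldr partial I (foldr angular J v))) = top"
      using IJ(1) finite_index_set ennreal_sum_eq_top by blast
    moreover have "ennreal ?K \<noteq> 0" using K by (simp only: ennreal_eq_0_iff not_le)
    ultimately have "ennreal ?K * (\<Sum>(I, J)\<in>index_set. L2_on {x. R \<le> norm x} (foldr partial I (foldr angular J v))) = top"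
      by (simp only: ennreal_mult_eq_top_iff) simp
    then show ?thesis by simp
  next
    case False
    define a where "a \<alpha> = sqrt (enn2real (N \<alpha>))" for \<alpha>
    have a: "N \<alpha> = ennreal ((a \<alpha>)\<^sup>2)" "0 \<le> a \<alpha>" if "\<alpha> \<in> index_set" for \<alpha>
      using False that by (auto simp: a_def less_top)
    have "ennreal ((norm x0)\<^sup>2 * \<bar>v x0\<bar>\<^sup>2) \<le> ennreal (4000000 * real (card index_set)) * (\<Sum>(I, J)\<in>index_set.
         \<integral>\<^sup>+ x \<in> {x. norm x0 \<le> norm x}. ennreal (\<bar>foldr partial I (foldr angular J v) x\<bar>\<^sup>2) \<partial>lborel)"
      using G(3) R by (intro exterior_estimate_squared[OF G(1,2)]) auto
    also have "\<dots> \<le> ennreal (4000000 * real (card index_set)) * (\<Sum>\<alpha>\<in>index_set. N \<alpha>)"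
      unfolding N_def using R
      by (intro mult_left_mono sum_mono) (auto intro!: nn_integral_mono split: split_indicator)
    also have "\<dots> = ennreal (4000000 * real (card index_set) * (\<Sum>\<alpha>\<in>index_set. (a \<alpha>)\<^sup>2))"
      by (simp add: a ennreal_mult sum_nonneg flip: sum_ennreal cong: sum.cong)
    finally have "(norm x0)\<^sup>2 * \<bar>v x0\<bar>\<^sup>2 \<le> 4000000 * real (card index_set) * (\<Sum>\<alpha>\<in>index_set. (a \<alpha>)\<^sup>2)"
      by (subst (asm) ennreal_le_iff) (auto intro!: mult_nonneg_nonneg sum_nonneg)
    also have "\<dots> \<le> 4000000 * real (card index_set) * (\<Sum>\<alpha>\<in>index_set. a \<alpha>)\<^sup>2"
      using L2_set_le_sum[of index_set a] a(2) unfolding L2_set_def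
      by (intro mult_left_mono sqrt_le_D) auto
    finally have "(norm x0 * \<bar>v x0\<bar>)\<^sup>2 \<le> (2000 * sqrt (real (card index_set)) * (\<Sum>\<alpha>\<in>index_set. a \<alpha>))\<^sup>2"
      by (simp add: power_mult_distrib)
    then have "norm x0 * \<bar>v x0\<bar> \<le> 2000 * sqrt (real (card index_set)) * (\<Sum>\<alpha>\<in>index_set. a \<alpha>)"
      by (rule power2_le_imp_le) (auto intro!: mult_nonneg_nonneg sum_nonneg simp: a)
    moreover have "(1 + norm x0) * \<bar>v x0\<bar> \<le> 2 * (norm x0 * \<bar>v x0\<bar>)"
      using R mult_right_mono[of 1 "norm x0" "\<bar>v x0\<bar>"] by (simp add: algebra_simps)
    ultimately have "(1 + norm x0) * \<bar>v x0\<bar> \<le> sobolev_const * (\<Sum>\<alpha>\<in>index_set. a \<alpha>)"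
      by (simp add: sobolev_const_def)
    moreover have "0 < 1 + norm x0" by (simp add: add_pos_nonneg)
    ultimately have "\<bar>v x0\<bar> \<le> ?K * (\<Sum>\<alpha>\<in>index_set. a \<alpha>)"
      by (simp add: field_simps)
    then have "ennreal \<bar>v x0\<bar> \<le> ennreal (?K * (\<Sum>\<alpha>\<in>index_set. a \<alpha>))"
      by (rule ennreal_leI)
    also have "\<dots> = ennreal ?K * ennreal (\<Sum>\<alpha>\<in>index_set. a \<alpha>)"
      using K a(2) by (intro ennreal_mult sum_nonneg) auto
    also have "ennreal (\<Sum>\<alpha>\<in>index_set. a \<alpha>) = (\<Sum>(I, J)\<in>index_set. L2_on {x. R \<le> norm x} (foldr partial I (foldr angular J v)))"
      unfolding L2 using False a(2) by (auto simp: a_def case_prod_beta intro!: sum.cong simp flip: sum_ennreal)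
    finally show ?thesis .
  qed
qed

section \<open>The estimate on a graph\<close>

text \<open>
  For the height of a slice this is \<open>d_bar\<close>, for a constant height it is \<open>d_x\<close>. Treating the height
  as a parameter lets one proof serve both inequalities.
\<close>

definition tangential :: "(real^3 \<Rightarrow> real) \<Rightarrow> 3 \<Rightarrow> (spacetime \<Rightarrow> real) \<Rightarrow> spacetime \<Rightarrow> real" where
  "tangential h a u p = frechet_derivative h (at (snd p)) (axis a 1) * d_t u p + d_x a u p"

lemma Ck_on_tangential:
  assumes "open N" "Ck_on (Suc k) N h" "open U" "U \<subseteq> snd -` N" "Ck_on (Suc k) U w"
  shows "Ck_on k U (tangential h a w)"
  unfolding tangential_def[abs_def] d_t_def[abs_def] d_x_def[abs_def]
  by (intro Ck_on_add Ck_on_mult assms(3) Ck_on_Suc_derivative[OF assms(5)]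
      Ck_on_subset[OF Ck_on_snd[OF assms(1) Ck_on_Suc_derivative[OF assms(2)]] assms(4)])

lemma Ck_on_rot:
  assumes "open U" "Ck_on (Suc k) U w"
  shows "Ck_on k U (rot p w)"
proof (cases p)
  case (Pair a b)
  have "Ck_on k U (\<lambda>p. snd p $ c)" for c
    using bounded_linear_compose[OF bounded_linear_vec_nth[of c] bounded_linear_snd]
    by (rule Ck_on_bounded_linear[OF assms(1)])
  then show ?thesis
    unfolding Pair rot_def prod.case d_x_def
    by (intro Ck_on_diff Ck_on_mult assms(1) Ck_on_Suc_derivative[OF assms(2)])
qed

lemma tangential_on_graph:
  assumes "Ck_on (Suc j) U w" "Ck_on (Suc k) N h" "x \<in> N" "(h x, x) \<in> U"
  shows "tangential h a w (h x, x) = partial a (\<lambda>x. w (h x, x)) x"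
  using frechet_derivative_at[OF has_derivative_along_graph[OF assms], symmetric]
  by (simp add: partial_def tangential_def d_t_def d_x_def)

text \<open>
  Differentiating along the graph adds \<open>\<partial>\<^sub>a h\<close> times the time derivative to each \<open>\<partial>\<^sub>a\<close>. In a rotation
  these additions cancel because the height is radial.
\<close>

lemma rot_on_graph:
  assumes "Ck_on (Suc j) U w" "Ck_on (Suc k) N h" "x \<in> N" "(h x, x) \<in> U"
    and radial: "\<And>a b. x $ a * partial b h x = x $ b * partial a h x"
  shows "rot p w (h x, x) = angular p (\<lambda>x. w (h x, x)) x"
proof (cases p)
  case (Pair a b)
  have *: "d_x c w (h x, x) = partial c (\<lambda>x. w (h x, x)) x - partial c h x * d_t w (h x, x)" for c
    using tangential_on_graph[OF assms(1-4), of c] by (simp add: tangential_def partial_def)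
  have "x $ a * (partial b h x * d_t w (h x, x)) = x $ b * (partial a h x * d_t w (h x, x))"
    using radial[of a b] by (simp add: mult.assoc[symmetric])
  from this[symmetric] show ?thesis
    by (simp add: Pair rot_def angular_def * right_diff_distrib)
qed

context
  fixes N :: "(real^3) set" and h :: "real^3 \<Rightarrow> real" and U :: "spacetime set" and G :: "(real^3) set"
  assumes N: "open N" "Ck_on 2 N h" and U: "open U" "U \<subseteq> snd -` N"
    and G: "open G" "\<And>x. x \<in> G \<Longrightarrow> (h x, x) \<in> U"
    and radial: "\<And>x a b. x \<in> G \<Longrightarrow> x $ a * partial b h x = x $ b * partial a h x"
begin

lemma foldr_rot_on_graph:
  assumes "Ck_on (length J + k) U u"
  shows "Ck_on k U (foldr rot J u)
    \<and> (\<forall>x\<in>G. foldr rot J u (h x, x) = foldr angular J (\<lambda>x. u (h x, x)) x)"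
  using assms
proof (induction J arbitrary: k)
  case (Cons p J)
  let ?w = "foldr rot J u"
  have "Ck_on (length J + Suc k) U u" using Cons.prems by (simp only: list.size add_Suc add_Suc_right add_0_right)
  from Cons.IH[OF this]
  have w: "Ck_on (Suc k) U ?w"
    and eq: "\<And>x. x \<in> G \<Longrightarrow> ?w (h x, x) = foldr angular J (\<lambda>x. u (h x, x)) x"
    by blast+
  have "rot p ?w (h x, x) = angular p (foldr angular J (\<lambda>x. u (h x, x))) x" if "x \<in> G" for x
  proof -
    have "rot p ?w (h x, x) = angular p (\<lambda>x. ?w (h x, x)) x"
      using G(2)[OF that] U(2)
      by (intro rot_on_graph[OF w N(2)[unfolded numeral_2_eq_2] _ _ radial[OF that]]) auto
    also have "\<dots> = angular p (foldr angular J (\<lambda>x. u (h x, x))) x"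
      by (rule angular_cong[OF G(1) that eq])
    finally show ?thesis .
  qed
  then show ?case using Ck_on_rot[OF U(1) w] unfolding foldr.simps o_apply by blast
qed simp

text \<open>
  Each tangent field costs one derivative of the height, which has only two; this limits the number
  of fields.
\<close>

lemma foldr_tangential_on_graph:
  assumes "Ck_on (length I + k) U w" "length I + k \<le> 2"
  shows "Ck_on k U (foldr (tangential h) I w)
    \<and> (\<forall>x\<in>G. foldr (tangential h) I w (h x, x) = foldr partial I (\<lambda>x. w (h x, x)) x)"
  using assms
proof (induction I arbitrary: k)
  case (Cons a I)
  let ?w = "foldr (tangential h) I w"
  have "Ck_on (length I + Suc k) U w" "length I + Suc k \<le> 2"
    using Cons.prems by (simp_all only: list.size add_Suc add_Suc_right add_0_right)
  from Cons.IH[OF this]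
  have w: "Ck_on (Suc k) U ?w"
    and eq: "\<And>x. x \<in> G \<Longrightarrow> ?w (h x, x) = foldr partial I (\<lambda>x. w (h x, x)) x"
    by blast+
  have h: "Ck_on (Suc k) N h"
    using Cons.prems(2) by (intro Ck_on_mono[OF _ N(2)]) simp
  have "tangential h a ?w (h x, x) = partial a (foldr partial I (\<lambda>x. w (h x, x))) x" if "x \<in> G" for x
  proof -
    have "tangential h a ?w (h x, x) = partial a (\<lambda>x. ?w (h x, x)) x"
      using G(2)[OF that] U(2) by (intro tangential_on_graph[OF w h]) auto
    also have "\<dots> = partial a (foldr partial I (\<lambda>x. w (h x, x))) x"
      by (rule partial_cong[OF G(1) that eq])
    finally show ?thesis .
  qed
  then show ?case using Ck_on_tangential[OF N(1) h U w] unfolding foldr.simps o_apply by blast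
qed simp

lemma derivs_on_graph:
  assumes "Ck_on 2 U u" "(I, J) \<in> index_set" "x \<in> G"
  shows "foldr (tangential h) I (foldr rot J u) (h x, x) = foldr partial I (foldr angular J (\<lambda>x. u (h x, x))) x"
proof -
  have le: "length I + length J \<le> 2" using assms(2) by (simp add: index_set_def)
  have "Ck_on (length J + length I) U u" using le by (intro Ck_on_mono[OF _ assms(1)]) simp
  from foldr_rot_on_graph[OF this]
  have w: "Ck_on (length I + 0) U (foldr rot J u)"
    and eq: "\<And>x. x \<in> G \<Longrightarrow> foldr rot J u (h x, x) = foldr angular J (\<lambda>x. u (h x, x)) x" by auto
  have cong: "\<forall>x\<in>G. foldr partial I f x = foldr partial I g x" if "\<forall>x\<in>G. f x = g x" for f g :: "real^3 \<Rightarrow> real"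
  proof (induction I)
    case (Cons a I)
    then show ?case by (auto simp only: foldr.simps o_apply intro: partial_cong[OF G(1)])
  qed (use that in simp)
  have "foldr partial I (\<lambda>x. foldr rot J u (h x, x)) x = foldr partial I (foldr angular J (\<lambda>x. u (h x, x))) x"
    by (rule bspec[OF cong assms(3)], rule ballI, rule eq)
  moreover have "foldr (tangential h) I (foldr rot J u) (h x, x) = foldr partial I (\<lambda>x. foldr rot J u (h x, x)) x"
    using le by (intro bspec[OF conjunct2[OF foldr_tangential_on_graph[OF w]] assms(3)]) simp
  ultimately show ?thesis by (simp only:)
qed

end

lemma exterior_estimate_on_graph:
  fixes h :: "real^3 \<Rightarrow> real"
  assumes N: "open N" "Ck_on 2 N h" "{x. R \<le> norm x} \<subseteq> N"
    and radial: "\<And>x a b. x \<in> N \<Longrightarrow> x $ a * partial b h x = x $ b * partial a h x"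
    and U: "open U" "Ck_on 2 U u" "\<And>x. R \<le> norm x \<Longrightarrow> (h x, x) \<in> U"
    and R: "1 \<le> R" "R \<le> norm x0"
  shows "ennreal \<bar>u (h x0, x0)\<bar> \<le> ennreal (sobolev_const * inverse (1 + norm x0))
     * (\<Sum>(I, J)\<in>index_set. L2_on {x. R \<le> norm x} (\<lambda>x. foldr (tangential h) I (foldr rot J u) (h x, x)))"
proof -
  \<comment> \<open>The tangent fields have regular coefficients only over \<open>N\<close>.\<close>
  define U' where "U' = U \<inter> snd -` N"
  have U': "open U'" "U' \<subseteq> snd -` N" "Ck_on 2 U' u"
    using open_Int[OF U(1) open_vimage_snd[OF N(1)]] Ck_on_subset[OF U(2)] by (auto simp only: U'_def)
  define G where "G = N \<inter> (\<lambda>x. (h x, x)) -` U'"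
  have "continuous_on N h" using Ck_on_mono[OF _ N(2), of 0] by simp
  then have "continuous_on N (\<lambda>x. (h x, x))"
    by (rule continuous_on_Pair) (rule continuous_on_id)
  from continuous_open_preimage[OF this N(1) U'(1)]
  have G: "open G" "G \<subseteq> N" "\<And>x. x \<in> G \<Longrightarrow> (h x, x) \<in> U'"
    unfolding G_def by auto
  have ext: "{x. R \<le> norm x} \<subseteq> G"
    using N(3) U(3) by (auto simp: G_def U'_def)
  have "L2_on {x. R \<le> norm x} (\<lambda>x. foldr (tangential h) I (foldr rot J u) (h x, x))
      = L2_on {x. R \<le> norm x} (foldr partial I (foldr angular J (\<lambda>x. u (h x, x))))"
    if "(I, J) \<in> index_set" for I J
  proof -
    have "foldr (tangential h) I (foldr rot J u) (h x, x) = foldr partial I (foldr angular J (\<lambda>x. u (h x, x))) x"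
      if "R \<le> norm x" for x
      using ext that G radial \<open>(I, J) \<in> index_set\<close>
      by (intro derivs_on_graph[OF N(1,2) U'(1,2) G(1) _ _ U'(3)]) auto
    then have "(\<integral>\<^sup>+ x \<in> {x. R \<le> norm x}. ennreal (\<bar>foldr (tangential h) I (foldr rot J u) (h x, x)\<bar>\<^sup>2) \<partial>lborel)
        = (\<integral>\<^sup>+ x \<in> {x. R \<le> norm x}. ennreal (\<bar>foldr partial I (foldr angular J (\<lambda>x. u (h x, x))) x\<bar>\<^sup>2) \<partial>lborel)"
      by (intro nn_integral_cong) (auto split: split_indicator)
    then show ?thesis by (simp add: L2_on_def)
  qed
  then have "(\<Sum>(I, J)\<in>index_set. L2_on {x. R \<le> norm x} (\<lambda>x. foldr (tangential h) I (foldr rot J u) (h x, x)))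
     = (\<Sum>(I, J)\<in>index_set. L2_on {x. R \<le> norm x} (foldr partial I (foldr angular J (\<lambda>x. u (h x, x)))))"
    by (intro sum.cong) auto
  then show ?thesis
    using exterior_estimate[OF G(1) Ck_on_along_graph[OF G U'(3) N(2)] ext R] by simp
qed

section \<open>The slices\<close>

lemma chi_mono: "chi x \<le> chi y" if "x \<le> y"
proof (rule DERIV_nonneg_imp_nondecreasing[OF that])
  show "\<exists>d. (chi has_real_derivative d) (at z) \<and> 0 \<le> d" for z
    by (rule exI, rule conjI, rule chi_has_derivative) (use rho_nonneg[of z] rho0_pos in simp)
qed

lemma chi_le_1: "chi y \<le> 1" and chi_nonneg: "0 \<le> chi y"
  using chi_mono[of y "max 1 y"] chi_mono[of "min 0 y" y] chi_eq_1[of "max 1 y"] chi_eq_0[of "min 0 y"] by auto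

lemma transition_fun_bounds: "0 \<le> transition_fun s r" "transition_fun s r \<le> 1"
  using chi_le_1 chi_nonneg by (auto simp: transition_fun_def)

lemma sqrt_sum_has_derivative:
  assumes "0 < s"
  shows "((\<lambda>r. sqrt (r\<^sup>2 + s\<^sup>2)) has_real_derivative r / sqrt (r\<^sup>2 + s\<^sup>2)) (at r within T)"
proof -
  have "0 < r\<^sup>2 + s\<^sup>2" using assms by (simp add: add_nonneg_pos)
  from DERIV_real_sqrt[OF this]
  have "((\<lambda>r. sqrt (r\<^sup>2 + s\<^sup>2)) has_real_derivative inverse (sqrt (r\<^sup>2 + s\<^sup>2)) / 2 * (2 * r)) (at r within T)"
    by (rule DERIV_chain2) (auto intro!: derivative_eq_intros)
  moreover have "inverse a / 2 * (2 * r) = r / a" for a :: real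
    by (cases "a = 0") (simp_all add: field_simps)
  ultimately show ?thesis by (simp only:)
qed

text \<open>
  The slices are ordered by their parameter, hence a slice with parameter between \<open>s0\<close> and \<open>s1\<close> lies
  in the slab near which \<open>u\<close> is smooth. The transition function increases with \<open>s\<close> and is at
  most one, whereas the factor \<open>r / sqrt (r\<^sup>2 + s\<^sup>2)\<close> decreases. So the difference of the slopes is
  bounded below by its value for transition function one, that is, by the difference of the slopes
  of two hyperboloids, and hyperboloids are ordered.
\<close>

lemma slice_time_mono:
  assumes "2 \<le> s" "s \<le> s'" "0 \<le> r"
  shows "slice_time s r \<le> slice_time s' r"
proof -
  let ?k = "\<lambda>\<rho>. \<rho> / sqrt (\<rho>\<^sup>2 + s'\<^sup>2) - \<rho> / sqrt (\<rho>\<^sup>2 + s\<^sup>2)"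
  have int: "slice_time_rhs s integrable_on {0..r}" "slice_time_rhs s' integrable_on {0..r}"
    using assms by (auto intro!: integrable_continuous_real continuous_on_slice_time_rhs)
  have "(?k has_integral (sqrt (r\<^sup>2 + s'\<^sup>2) - sqrt (r\<^sup>2 + s\<^sup>2)) - (sqrt (0\<^sup>2 + s'\<^sup>2) - sqrt (0\<^sup>2 + s\<^sup>2))) {0..r}"
  proof (rule fundamental_theorem_of_calculus)
    show "((\<lambda>r. sqrt (r\<^sup>2 + s'\<^sup>2) - sqrt (r\<^sup>2 + s\<^sup>2)) has_vector_derivative ?k \<rho>) (at \<rho> within {0..r})" for \<rho>
      unfolding has_real_derivative_iff_has_vector_derivative[symmetric]
      using assms by (intro DERIV_diff sqrt_sum_has_derivative) auto
  qed (rule assms)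
  then have k: "(?k has_integral (sqrt (r\<^sup>2 + s'\<^sup>2) - sqrt (r\<^sup>2 + s\<^sup>2)) - (s' - s)) {0..r}"
    using assms by simp
  have "?k \<rho> \<le> slice_time_rhs s' \<rho> - slice_time_rhs s \<rho>" if "\<rho> \<in> {0..r}" for \<rho>
  proof -
    let ?A = "\<rho> / sqrt (\<rho>\<^sup>2 + s\<^sup>2)" and ?B = "\<rho> / sqrt (\<rho>\<^sup>2 + s'\<^sup>2)"
    have "s\<^sup>2 \<le> s'\<^sup>2" using assms by (intro power_mono) auto
    then have "transition_fun s \<rho> \<le> transition_fun s' \<rho>"
      by (auto simp: transition_fun_def intro: chi_mono)
    moreover have A: "0 \<le> ?A" using that by simp
    moreover have "0 < \<rho>\<^sup>2 + s\<^sup>2" using assms(1) by (simp add: add_nonneg_pos)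
    then have "?B \<le> ?A" using \<open>s\<^sup>2 \<le> s'\<^sup>2\<close> that by (intro divide_left_mono real_sqrt_le_mono mult_pos_pos) auto
    ultimately have "transition_fun s \<rho> * ?A \<le> transition_fun s' \<rho> * ?A"
      "transition_fun s' \<rho> * (?A - ?B) \<le> 1 * (?A - ?B)"
      using transition_fun_bounds(2)[of s' \<rho>] by (intro mult_right_mono; simp)+
    moreover have "chi (s - 1) = 1" "chi (s' - 1) = 1" using assms by (auto intro: chi_eq_1)
    ultimately show ?thesis by (simp add: slice_time_rhs_def right_diff_distrib)
  qed
  from has_integral_le[OF k has_integral_diff[OF integrable_integral[OF int(2)] integrable_integral[OF int(1)]] this]
  have "(sqrt (r\<^sup>2 + s'\<^sup>2) - sqrt (r\<^sup>2 + s\<^sup>2)) - (s' - s) \<le> slice_time s' r - s' - (slice_time s r - s)"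
    by (simp add: slice_time_def)
  moreover have "sqrt (r\<^sup>2 + s\<^sup>2) \<le> sqrt (r\<^sup>2 + s'\<^sup>2)"
    using assms by (intro real_sqrt_le_mono add_left_mono power_mono) auto
  ultimately show ?thesis by linarith
qed

lemma slice_time_exterior:
  assumes "1 \<le> s" "s\<^sup>2 / 2 \<le> r"
  shows "slice_time s r = slice_time s (s\<^sup>2 / 2)"
proof -
  have "slice_time_rhs s integrable_on {0..r}"
    using assms by (auto intro!: integrable_continuous_real continuous_on_slice_time_rhs)
  then have "integral {0..s\<^sup>2 / 2} (slice_time_rhs s) + integral {s\<^sup>2 / 2..r} (slice_time_rhs s)
      = integral {0..r} (slice_time_rhs s)"
    using assms by (intro Henstock_Kurzweil_Integration.integral_combine) auto
  moreover have "integral {s\<^sup>2 / 2..r} (slice_time_rhs s) = integral {s\<^sup>2 / 2..r} (\<lambda>_. 0)"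
    by (rule integral_cong) (auto simp: slice_time_rhs_def transition_fun_def intro!: chi_eq_1)
  ultimately show ?thesis by (simp add: slice_time_def)
qed

text \<open>
  The radial derivative of the height divided by the radius. With this quotient the gradient of the
  height at \<open>x\<close> is a radial function times \<open>x\<close> itself, which is easy to differentiate again.
\<close>

definition slice_slope :: "real \<Rightarrow> real \<Rightarrow> real" where
  "slice_slope s r = chi (s - 1) * transition_fun s r / sqrt (r\<^sup>2 + s\<^sup>2)"

lemma has_derivative_radial:
  fixes x :: "'a::real_inner"
  assumes "(f has_real_derivative D) (at (norm x))" "x \<noteq> 0"
  shows "((\<lambda>y. f (norm y)) has_derivative (\<lambda>k. D * (k \<bullet> sgn x))) (at x)"
  using has_derivative_compose[OF has_derivative_norm[OF assms(2)] assms(1)[unfolded has_field_derivative_def]]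
  by simp

lemma has_derivative_slice_height:
  fixes x :: "'a::real_inner"
  assumes "1 \<le> s" "x \<noteq> 0"
  shows "((\<lambda>y. slice_time s (norm y)) has_derivative (\<lambda>k. slice_slope s (norm x) * (x \<bullet> k))) (at x)"
proof -
  have "at (norm x) within {0..} = at (norm x)"
    using assms(2) by (intro at_within_interior) auto
  then have "(slice_time s has_real_derivative
      chi (s - 1) * transition_fun s (norm x) * (norm x / sqrt ((norm x)\<^sup>2 + s\<^sup>2))) (at (norm x))"
    using slice_time_has_derivative[OF assms(1), of "norm x"] by simp
  from has_derivative_radial[OF this assms(2)] show ?thesis
  proof (rule has_derivative_eq_rhs, intro ext)
    fix k
    have "k \<bullet> sgn x = (x \<bullet> k) / norm x" by (simp add: sgn_div_norm inner_commute divide_inverse)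
    then show "chi (s - 1) * transition_fun s (norm x) * (norm x / sqrt ((norm x)\<^sup>2 + s\<^sup>2)) * (k \<bullet> sgn x)
        = slice_slope s (norm x) * (x \<bullet> k)"
      using assms(2) by (simp add: slice_slope_def)
  qed
qed

text \<open>
  Two derivatives of the height exist because its slope involves \<open>chi\<close>, whose derivative is a multiple
  of the continuous function \<open>rho\<close>; composing twice with tangent fields requires no more.
\<close>

lemma Ck_on_slice_height:
  assumes "1 \<le> s"
  shows "Ck_on 2 (- {0}) (\<lambda>y :: real^3. slice_time s (norm y))"
proof -
  have o: "open (- {0 :: real^3})" by (intro open_Compl closed_singleton)
  define d where "d r = chi (s - 1) * ((- (inverse rho0 * rho (r + 1 - s\<^sup>2 / 2))) * sqrt (r\<^sup>2 + s\<^sup>2)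
      - transition_fun s r * (r / sqrt (r\<^sup>2 + s\<^sup>2))) / (r\<^sup>2 + s\<^sup>2)" for r
  have pos: "0 < r\<^sup>2 + s\<^sup>2" for r using assms by (simp add: add_nonneg_pos)
  have dtrans: "(transition_fun s has_real_derivative - (inverse rho0 * rho (r + 1 - s\<^sup>2 / 2))) (at r)" for r
  proof -
    have "((\<lambda>r. r + 1 - s\<^sup>2 / 2) has_real_derivative 1) (at r)"
      by (auto intro!: derivative_eq_intros)
    from DERIV_diff[OF DERIV_const[of 1] DERIV_chain2[OF chi_has_derivative this]] show ?thesis
      by (simp add: transition_fun_def[abs_def])
  qed
  have dslope: "(slice_slope s has_real_derivative d r) (at r)" for r
  proof -
    have "sqrt (r\<^sup>2 + s\<^sup>2) \<noteq> 0" using real_sqrt_gt_zero[OF pos[of r]] by linarith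
    from DERIV_cmult[OF DERIV_divide[OF dtrans sqrt_sum_has_derivative this], of "chi (s - 1)"]
    show ?thesis using assms pos[of r] by (simp add: slice_slope_def[abs_def] d_def)
  qed
  have contd: "continuous_on UNIV d"
  proof -
    have "continuous_on UNIV (transition_fun s)"
      using dtrans by (meson DERIV_isCont continuous_at_imp_continuous_on)
    moreover have "continuous_on UNIV (\<lambda>r. rho (r + 1 - s\<^sup>2 / 2))"
      by (rule continuous_on_compose2[OF continuous_on_rho[of UNIV]]) (auto intro!: continuous_intros)
    ultimately show ?thesis
      unfolding d_def[abs_def] using pos
      by (intro continuous_intros) (auto simp: less_imp_neq[symmetric])
  qed
  have C1: "Ck_on (Suc 0) (- {0}) (\<lambda>y :: real^3. slice_slope s (norm y))"
  proof (rule Ck_on_SucI[OF o has_derivative_radial[OF dslope]])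
    show "Ck_on 0 (- {0}) (\<lambda>y :: real^3. d (norm y) * (v \<bullet> sgn y))" for v
      unfolding Ck_on.simps sgn_div_norm
      by (intro continuous_intros continuous_on_compose2[OF contd]) auto
  qed simp
  have "Ck_on (Suc (Suc 0)) (- {0}) (\<lambda>y :: real^3. slice_time s (norm y))"
  proof (rule Ck_on_SucI[OF o has_derivative_slice_height[OF assms]])
    show "Ck_on (Suc 0) (- {0}) (\<lambda>y :: real^3. slice_slope s (norm y) * (y \<bullet> v))" for v
      by (intro Ck_on_mult[OF o C1] Ck_on_bounded_linear[OF o] bounded_linear_inner_left)
  qed simp
  then show ?thesis by (simp only: numeral_2_eq_2)
qed

lemma slice_height_radial:
  assumes "1 \<le> s" "x \<noteq> 0"
  shows "x $ a * partial b (\<lambda>y :: real^3. slice_time s (norm y)) x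
    = x $ b * partial a (\<lambda>y. slice_time s (norm y)) x"
  using frechet_derivative_at[OF has_derivative_slice_height[OF assms], symmetric]
  by (simp add: partial_def inner_axis)

lemma snd_slice_tran_ext: "snd ` (slice_tran s \<union> slice_ext s) = {x. - 1 + s\<^sup>2 / 2 \<le> norm x}"
proof (intro equalityI subsetI)
  fix x :: "real^3" assume "x \<in> {x. - 1 + s\<^sup>2 / 2 \<le> norm x}"
  then have "(slice_time s (norm x), x) \<in> slice_tran s \<union> slice_ext s"
    by (auto simp: slice_tran_def slice_ext_def)
  then show "x \<in> snd ` (slice_tran s \<union> slice_ext s)" by (rule rev_image_eqI) simp
qed (auto simp: slice_tran_def slice_ext_def)

lemma snd_slice_ext: "snd ` slice_ext s = {x. s\<^sup>2 / 2 \<le> norm x}"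
proof (intro equalityI subsetI)
  fix x :: "real^3" assume "x \<in> {x. s\<^sup>2 / 2 \<le> norm x}"
  then have "(slice_time s (norm x), x) \<in> slice_ext s" by (simp add: slice_ext_def)
  then show "x \<in> snd ` slice_ext s" by (rule rev_image_eqI) simp
qed (auto simp: slice_ext_def)

lemma L2_slice_eq: "L2_slice s A v = L2_on (snd ` A) (\<lambda>x. v (slice_time s (norm x), x))"
  by (simp add: L2_slice_def L2_on_def)

lemma d_bar_eq: "d_bar s = tangential (\<lambda>y. slice_time s (norm y))"
  by (intro ext) (simp add: d_bar_def tangential_def)

lemma d_x_eq: "d_x = tangential (\<lambda>_. c)"
  by (intro ext) (simp add: tangential_def)

theorem proposition2p1:
  "\<exists>C>0. \<forall>(s0::real) s s1 (u :: spacetime \<Rightarrow> real).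
     2 \<le> s0 \<and> s0 \<le> s \<and> s \<le> s1 \<and> smooth_near (slab s0 s1) u \<longrightarrow>
       (\<forall>(t, x) \<in> slice_tran s \<union> slice_ext s.
          ennreal \<bar>u (t, x)\<bar> \<le> ennreal (C * inverse (1 + norm x)) *
            (\<Sum>(I, J) \<in> index_set.
               L2_slice s (slice_tran s \<union> slice_ext s)
                 (compose_ops (d_bar s) I (compose_ops rot J u)))) \<and>
       (\<forall>(t, x) \<in> slice_ext s.
          ennreal \<bar>u (t, x)\<bar> \<le> ennreal (C * inverse (1 + norm x)) *
            (\<Sum>(I, J) \<in> index_set.
               L2_slice s (slice_ext s)
                 (compose_ops d_x I (compose_ops rot J u))))"
proof (intro exI[of _ sobolev_const] conjI sobolev_const_pos allI impI)
  fix s0 s s1 :: real and u :: "spacetime \<Rightarrow> real"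
  assume A: "2 \<le> s0 \<and> s0 \<le> s \<and> s \<le> s1 \<and> smooth_near (slab s0 s1) u"
  then have s: "2 \<le> s0" "s0 \<le> s" "s \<le> s1" "1 \<le> s" "2 \<le> s" by auto
  from A obtain U where U: "open U" "slab s0 s1 \<subseteq> U" "Ck_on 2 U u"
    unfolding smooth_near_def by blast
  have inU: "(slice_time s (norm x), x) \<in> U" for x
    using s by (intro subsetD[OF U(2)]) (auto simp: slab_def intro!: slice_time_mono)
  have "2\<^sup>2 \<le> s\<^sup>2" using s(5) by (intro power_mono) auto
  then have R: "1 \<le> - 1 + s\<^sup>2 / 2" "1 \<le> s\<^sup>2 / 2" by auto
  show "\<forall>(t, x) \<in> slice_tran s \<union> slice_ext s.
          ennreal \<bar>u (t, x)\<bar> \<le> ennreal (sobolev_const * inverse (1 + norm x)) *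
            (\<Sum>(I, J) \<in> index_set.
               L2_slice s (slice_tran s \<union> slice_ext s)
                 (compose_ops (d_bar s) I (compose_ops rot J u)))"
  proof (intro ballI, clarify)
    fix t x assume tx: "(t, x) \<in> slice_tran s \<union> slice_ext s"
    then have t: "t = slice_time s (norm x)" and x: "- 1 + s\<^sup>2 / 2 \<le> norm x"
      by (auto simp: slice_tran_def slice_ext_def)
    show "ennreal \<bar>u (t, x)\<bar> \<le> ennreal (sobolev_const * inverse (1 + norm x)) *
            (\<Sum>(I, J) \<in> index_set. L2_slice s (slice_tran s \<union> slice_ext s)
                 (compose_ops (d_bar s) I (compose_ops rot J u)))"
      unfolding t L2_slice_eq snd_slice_tran_ext compose_ops_def d_bar_eq
    proof (rule exterior_estimate_on_graph[where N = "- {0}" and U = U])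
      show "Ck_on 2 (- {0}) (\<lambda>y :: real^3. slice_time s (norm y))"
        by (rule Ck_on_slice_height[OF s(4)])
      show "y $ a * partial b (\<lambda>y. slice_time s (norm y)) y = y $ b * partial a (\<lambda>y. slice_time s (norm y)) y"
        if "y \<in> - {0}" for y a b
        using that by (intro slice_height_radial s(4)) auto
    qed (use R x U inU in auto)
  qed
  show "\<forall>(t, x) \<in> slice_ext s.
          ennreal \<bar>u (t, x)\<bar> \<le> ennreal (sobolev_const * inverse (1 + norm x)) *
            (\<Sum>(I, J) \<in> index_set.
               L2_slice s (slice_ext s) (compose_ops d_x I (compose_ops rot J u)))"
  proof (intro ballI, clarify)
    fix t x assume "(t, x) \<in> slice_ext s"
    define c where "c = slice_time s (s\<^sup>2 / 2)"
    have c: "slice_time s (norm y) = c" if "s\<^sup>2 / 2 \<le> norm y" for y :: "real^3"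
      unfolding c_def by (rule slice_time_exterior[OF s(4) that])
    have x: "s\<^sup>2 / 2 \<le> norm x" and t: "t = c"
      using \<open>(t, x) \<in> slice_ext s\<close> c[of x] by (auto simp: slice_ext_def)
    have "L2_slice s (slice_ext s) v = L2_on {x. s\<^sup>2 / 2 \<le> norm x} (\<lambda>x. v (c, x))" for v
    proof -
      have "(\<integral>\<^sup>+ x \<in> {x. s\<^sup>2 / 2 \<le> norm x}. ennreal (\<bar>v (slice_time s (norm x), x)\<bar>\<^sup>2) \<partial>lborel)
          = (\<integral>\<^sup>+ x \<in> {x. s\<^sup>2 / 2 \<le> norm x}. ennreal (\<bar>v (c, x)\<bar>\<^sup>2) \<partial>lborel)"
        by (intro nn_integral_cong) (auto simp: c split: split_indicator)
      then show ?thesis by (simp add: L2_slice_eq snd_slice_ext L2_on_def)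
    qed
    moreover have "ennreal \<bar>u (c, x)\<bar> \<le> ennreal (sobolev_const * inverse (1 + norm x)) *
        (\<Sum>(I, J) \<in> index_set. L2_on {x. s\<^sup>2 / 2 \<le> norm x}
           (\<lambda>x. foldr (tangential (\<lambda>_. c)) I (foldr rot J u) (c, x)))"
    proof (rule exterior_estimate_on_graph[where N = UNIV and U = U])
      show "(c, y) \<in> U" if "s\<^sup>2 / 2 \<le> norm y" for y :: "real^3"
        using inU[of y] c[OF that] by simp
    qed (use R x U in \<open>auto simp: partial_def intro: Ck_on_const\<close>)
    ultimately show "ennreal \<bar>u (t, x)\<bar> \<le> ennreal (sobolev_const * inverse (1 + norm x)) *
            (\<Sum>(I, J) \<in> index_set.
               L2_slice s (slice_ext s) (compose_ops d_x I (compose_ops rot J u)))"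
      unfolding t compose_ops_def by (simp add: d_x_eq[of c])
  qed
qed

end
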